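(* Fix $0 < \alpha \leqslant 2$ and let $V$ be a non-negative potential on $\mathbb{R}^d$ of the form $V(x) = V_1(x) + \dots + V_d(x)$, where each $V_i$ depends only on the $i$-th coordinate $x_i$ of $x$ and satisfies $$m |x_i|^\alpha \leqslant V_i(x) \leqslant M |x_i|^\alpha, \qquad x \in \mathbb{R}^d,\ i = 1,\dots,d,$$ with absolute constants $m, M > 0$. For $a > 0$ let the Riesz transform $R_V^a$ be defined by $$R_V^a f(x) = V(x)^a L^{-a} f(x) = \frac{V(x)^a}{\Gamma(a)} \int_0^\infty e^{-tL} f(x)\, t^{a-1}\, dt, \qquad L = -\tfrac12 \Delta + V.$$ Then there is a constant $C > 0$ depending on $m$, $M$, and $\alpha$ and independent of the dimension $d$ such that $$\| R_V^a f \|_{L^\infty(\mathbb{R}^d)} \leqslant C \| f \|_{L^\infty(\mathbb{R}^d)}, \qquad f \in L^\infty(\mathbb{R}^d).$$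
   Context: The semigroup $e^{-tL}$, $t>0$, generated by the Schrödinger operator $L = -\frac12\Delta + V$ on $\mathbb{R}^d$ is defined on $L^\infty(\mathbb{R}^d)$ by the Feynman--Kac formula $$e^{-tL} f(x) := \mathbb{E}_x\left[ e^{-\int_0^t V(X_s)\, ds} f(X_t) \right], \qquad f \in L^\infty(\mathbb{R}^d),$$ where $\mathbb{E}_x$ is the expectation with respect to the Wiener measure of the standard $d$-dimensional Brownian motion $\{X_s\}_{s>0}$ starting at $x \in \mathbb{R}^d$.
   Formalization: The constant C may also depend on a (besides m, M, α); a constant uniform in a does not exist: for d=1, V(x)=x², f=1 one has R_V^a f(x) ≥ (2a/e)^a at x²=√2·a, which is unbounded as a→∞. *)

theory Defs
  imports "HOL-Probability.Probability"
begin

text \<open>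
  The dimension \<open>d\<close> has to be a number rather than a type, since the constant in the theorem is
  uniform in \<open>d\<close>. So \<open>\<real>\<^sup>d\<close> is the product of \<open>d\<close> copies of Lebesgue-Borel measure; its points are
  the functions in \<open>{..<d} \<rightarrow>\<^sub>E UNIV\<close>.
\<close>

definition Rd :: "nat \<Rightarrow> (nat \<Rightarrow> real) measure" where
  "Rd d = (\<Pi>\<^sub>M i\<in>{..<d}. lborel)"

text \<open>
  Elements of \<open>L\<^sup>\<infinity>(\<real>\<^sup>d)\<close> are represented by Borel functions (every class has such a representative),
  which may be unbounded on null sets. The constant \<^const>\<open>esssup\<close> is infinite on functions that
  are not measurable, so a finite norm entails measurability of the modulus of the function.
\<close>

definition Linf_norm :: "nat \<Rightarrow> ((nat \<Rightarrow> real) \<Rightarrow> complex) \<Rightarrow> ereal" where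
  "Linf_norm d f = esssup (Rd d) (\<lambda>x. ereal (norm (f x)))"

definition Linf :: "nat \<Rightarrow> ((nat \<Rightarrow> real) \<Rightarrow> complex) set" where
  "Linf d = {f \<in> borel_measurable (Rd d). Linf_norm d f < \<infinity>}"

text \<open>
  The space \<open>C([0,\<infinity>), \<real>\<^sup>d)\<close> with the \<open>\<sigma>\<close>-algebra generated by the coordinate maps
  \<open>X\<^sub>s(\<omega>) = \<omega> s\<close>. Only its \<open>\<sigma>\<close>-algebra matters; the measure carried by the product is irrelevant.
\<close>

definition path_space :: "nat \<Rightarrow> (real \<Rightarrow> nat \<Rightarrow> real) measure" where
  "path_space d = restrict_space (\<Pi>\<^sub>M s\<in>{0..}. Rd d)
     {\<omega>. \<forall>i<d. continuous_on {0..} (\<lambda>s. \<omega> s i)}"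

text \<open>
  \<open>W\<close> is the law of standard \<open>d\<close>-dimensional Brownian motion started at \<open>x\<close>. Independence is
  required jointly over time steps \<open>k\<close> and coordinates \<open>i\<close>.
\<close>

definition wiener_measure :: "nat \<Rightarrow> (nat \<Rightarrow> real) \<Rightarrow> (real \<Rightarrow> nat \<Rightarrow> real) measure \<Rightarrow> bool" where
  "wiener_measure d x W \<longleftrightarrow>
     prob_space W \<and> sets W = sets (path_space d) \<and>
     (AE \<omega> in W. \<omega> 0 = x) \<and>
     (\<forall>s t. \<forall>i<d. 0 \<le> s \<and> s < t \<longrightarrow>
        distributed W lborel (\<lambda>\<omega>. \<omega> t i - \<omega> s i)
          (\<lambda>y. ennreal (normal_density 0 (sqrt (t - s)) y))) \<and>
     (\<forall>n. \<forall>t :: nat \<Rightarrow> real. 0 \<le> t 0 \<and> (\<forall>k<n. t k < t (Suc k)) \<longrightarrow>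
        prob_space.indep_vars W (\<lambda>_. borel)
          (\<lambda>(k, i) \<omega>. \<omega> (t (Suc k)) i - \<omega> (t k) i) ({..<n} \<times> {..<d}))"

text \<open>
  The semigroup \<open>e\<^sup>-\<^sup>t\<^sup>L f(x)\<close> with \<open>L = -\<Delta>/2 + V\<close>, given by the Feynman--Kac formula; \<open>W x\<close> is
  meant to be the Wiener measure started at \<open>x\<close>.
\<close>

definition semigroup_L ::
  "((nat \<Rightarrow> real) \<Rightarrow> (real \<Rightarrow> nat \<Rightarrow> real) measure) \<Rightarrow> ((nat \<Rightarrow> real) \<Rightarrow> real) \<Rightarrow> real \<Rightarrow>
   ((nat \<Rightarrow> real) \<Rightarrow> complex) \<Rightarrow> (nat \<Rightarrow> real) \<Rightarrow> complex" where
  "semigroup_L W V t f x =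
     (LINT \<omega>|W x. exp (- (LINT s:{0..t}|lborel. V (\<omega> s))) *\<^sub>R f (\<omega> t))"

definition riesz_transform ::
  "((nat \<Rightarrow> real) \<Rightarrow> (real \<Rightarrow> nat \<Rightarrow> real) measure) \<Rightarrow> ((nat \<Rightarrow> real) \<Rightarrow> real) \<Rightarrow> real \<Rightarrow>
   ((nat \<Rightarrow> real) \<Rightarrow> complex) \<Rightarrow> (nat \<Rightarrow> real) \<Rightarrow> complex" where
  "riesz_transform W V a f x =
     (V x powr a / Gamma a) *\<^sub>R
       (LINT t:{0<..}|lborel. t powr (a - 1) *\<^sub>R semigroup_L W V t f x)"

end

theory Submission
  imports Defs
begin

text \<open>
  Convexity of \<open>exp\<close> bounds \<open>exp (- \<integral>\<^sub>0\<^sup>t V(X\<^sub>s) ds)\<close>, for \<open>t = n h\<close>, by the average over \<open>r \<in> [0, h]\<close> of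
  \<open>exp (- h \<Sum>\<^sub>k V(X(k h + r)))\<close>, so only the Gaussian increments of a skeleton enter. Half of the
  first term \<open>k = 0\<close> factorises over the coordinates, and each factor is at most
  \<open>exp (- c h \<bar>x\<^sub>i\<bar>\<^sup>\<alpha>)\<close>. From the rest, \<open>\<bar>u\<bar>\<^sup>\<alpha> + \<bar>w\<bar>\<^sup>\<alpha> \<ge> \<bar>u - w\<bar>\<^sup>\<alpha> / 4\<close> extracts the increments of one
  coordinate, which are independent and give a factor \<open>q < 1\<close> each. With \<open>S = \<Sum>\<^sub>i \<bar>x\<^sub>i\<bar>\<^sup>\<alpha>\<close>, taking
  \<open>(h, n) = (t, 1)\<close> for \<open>t \<le> 1\<close> and \<open>(1, \<lfloor>t\<rfloor>)\<close> for \<open>t \<ge> 1\<close> yields a bound by a multiple of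
  \<open>exp (- \<delta> t) (exp (- c S t) + exp (- c S))\<close>, free of \<open>d\<close>, and integration against \<open>t\<^sup>a\<^sup>-\<^sup>1\<close>
  leaves at most a multiple of \<open>S\<^sup>-\<^sup>a\<close>, while \<open>V(x) \<le> M S\<close>.
\<close>

section \<open>Gaussian damping in one dimension\<close>

text \<open>The bound has to work at both ends of the time integral. Where \<open>S\<close> is small
  the starting point gives no damping, yet the integral must converge at infinity, so a factor
  \<open>exp (- \<delta> * t)\<close> has to come from the randomness of the path alone; one
  coordinate suffices for it, and using just one makes \<delta> independent of \<open>d\<close>. The
  damping at the start must instead be collected from all coordinates at a common rate. It is
  controlled only over steps of length at most 1, so large times retain
  \<open>exp (- (c * S))\<close> without a factor \<open>t\<close>; this is enough, since its
  product with \<open>S powr a\<close> stays bounded. Averaging over the offset \<open>r\<close>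
  replaces a whole path by finitely many times, and passing from positions to increments replaces
  dependent factors by independent ones. Two points concern \<open>f\<close> and \<open>W\<close>. A
  bound on \<open>f\<close> holds only off a null set, so the law of the position at a positive time
  has to be absolutely continuous. An essential supremum is infinite for non-measurable functions,
  so measurability in \<open>x\<close> has to be derived although nothing relates the measures
  \<open>W x\<close> beforehand.\<close>

lemma powr_exponent_le_one_plus_square:
  fixes y \<alpha> :: real
  assumes "0 < \<alpha>" "\<alpha> \<le> 2"
  shows "\<bar>y\<bar> powr \<alpha> \<le> 1 + y\<^sup>2"
proof (cases "\<bar>y\<bar> \<le> 1")
  case True
  then have "\<bar>y\<bar> powr \<alpha> \<le> 1"
    using assms powr_le1 by simp
  then show ?thesis using zero_le_power2[of y] by linarith
next
  case False
  then have "\<bar>y\<bar> powr \<alpha> \<le> \<bar>y\<bar> powr 2"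
    using assms by (intro powr_mono) auto
  also have "\<dots> = y\<^sup>2" using False by simp
  finally show ?thesis by simp
qed

text \<open>Bounding \<open>\<bar>a + b\<bar>\<close> by twice the larger modulus treats the
  subadditive range \<alpha> \<le> 1 and the convex range together; the 4 is
  \<open>2 powr \<alpha>\<close> at its largest.\<close>

lemma quarter_powr_le:
  fixes a b \<alpha> :: real
  assumes "0 < \<alpha>" "\<alpha> \<le> 2"
  shows "\<bar>a + b\<bar> powr \<alpha> / 4 \<le> \<bar>a\<bar> powr \<alpha> + \<bar>b\<bar> powr \<alpha>"
proof -
  have "\<bar>a + b\<bar> powr \<alpha> \<le> (2 * max \<bar>a\<bar> \<bar>b\<bar>) powr \<alpha>"
    using assms by (intro powr_mono2) auto
  also have "\<dots> = 2 powr \<alpha> * max \<bar>a\<bar> \<bar>b\<bar> powr \<alpha>"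
    by (simp add: powr_mult)
  also have "\<dots> \<le> 4 * max \<bar>a\<bar> \<bar>b\<bar> powr \<alpha>"
    using powr_mono[of \<alpha> 2 2] assms by (intro mult_right_mono) auto
  also have "\<dots> \<le> 4 * (\<bar>a\<bar> powr \<alpha> + \<bar>b\<bar> powr \<alpha>)"
    by (auto simp: max_def)
  finally show ?thesis by simp
qed

lemma nn_integral_normal_density:
  assumes "0 < \<sigma>"
  shows "(\<integral>\<^sup>+y. ennreal (normal_density \<mu> \<sigma> y) \<partial>lborel) = 1"
  using prob_space.emeasure_space_1[OF prob_space_normal_density[OF assms, of \<mu>]]
  by (subst (asm) emeasure_density) auto

text \<open>Spending half of the Gaussian exponent leaves a Gaussian of twice the variance. The
  price \<open>sqrt 2\<close> is free of \<open>s\<close>, which makes the damping uniform in the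
  time \<open>s\<close>.\<close>

lemma nn_integral_normal_density_exp_square:
  assumes "0 < s"
  shows "(\<integral>\<^sup>+y. ennreal (normal_density 0 (sqrt s) y * exp (y\<^sup>2 / (4 * s))) \<partial>lborel) = ennreal (sqrt 2)"
proof -
  have "normal_density 0 (sqrt s) y * exp (y\<^sup>2 / (4 * s)) = sqrt 2 * normal_density 0 (sqrt (2 * s)) y" for y
  proof -
    have "exp (- y\<^sup>2 / (2 * s)) * exp (y\<^sup>2 / (4 * s)) = exp (- y\<^sup>2 / (4 * s))"
      using assms by (simp add: mult_exp_exp field_simps)
    then show ?thesis
      using assms by (simp add: normal_density_def real_sqrt_mult field_simps)
  qed
  then have "(\<integral>\<^sup>+y. ennreal (normal_density 0 (sqrt s) y * exp (y\<^sup>2 / (4 * s))) \<partial>lborel)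
     = (\<integral>\<^sup>+y. ennreal (sqrt 2) * ennreal (normal_density 0 (sqrt (2 * s)) y) \<partial>lborel)"
    by (simp add: ennreal_mult)
  also have "\<dots> = ennreal (sqrt 2)"
    using assms by (subst nn_integral_cmult) (auto simp: nn_integral_normal_density)
  finally show ?thesis .
qed

text \<open>Symmetrisation: one of \<open>\<bar>x + y\<bar>\<close> and \<open>\<bar>x - y\<bar>\<close> is at least \<open>\<bar>x\<bar>\<close>.\<close>

lemma gaussian_damping_symmetrised:
  fixes x \<alpha> \<kappa> :: real
  assumes "0 < \<alpha>" "0 \<le> \<kappa>" "0 < s"
  shows "(\<integral>\<^sup>+y. ennreal (normal_density 0 (sqrt s) y * exp (- (\<kappa> * \<bar>x + y\<bar> powr \<alpha>))) \<partial>lborel)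
     \<le> ennreal ((1 + exp (- (\<kappa> * \<bar>x\<bar> powr \<alpha>))) / 2)" (is "?I \<le> ennreal ?B")
proof -
  define g where "g y = normal_density 0 (sqrt s) y * exp (- (\<kappa> * \<bar>x + y\<bar> powr \<alpha>))" for y
  have g_nonneg: "0 \<le> g y" for y by (simp add: g_def)
  have [measurable]: "g \<in> borel_measurable borel" unfolding g_def by measurable
  have sym: "?I = (\<integral>\<^sup>+y. ennreal (g (- y)) \<partial>lborel)"
    using nn_integral_real_affine[of "\<lambda>y. ennreal (g y)" "-1" 0] by (simp add: g_def)
  have pw: "g y + g (- y) \<le> 2 * ?B * normal_density 0 (sqrt s) y" for y
  proof -
    let ?e = "\<lambda>z. exp (- (\<kappa> * \<bar>z\<bar> powr \<alpha>))"
    have mono: "?e z \<le> ?e x" if "\<bar>x\<bar> \<le> \<bar>z\<bar>" for z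
      using that assms by (auto intro!: mult_left_mono powr_mono2)
    have le1: "?e z \<le> 1" for z using assms by simp
    have "\<bar>x\<bar> \<le> \<bar>x + y\<bar> \<or> \<bar>x\<bar> \<le> \<bar>x - y\<bar>" by linarith
    then have "?e (x + y) + ?e (x - y) \<le> 1 + ?e x"
      using mono[of "x + y"] mono[of "x - y"] le1[of "x + y"] le1[of "x - y"] by linarith
    then have "normal_density 0 (sqrt s) y * (?e (x + y) + ?e (x - y)) \<le> normal_density 0 (sqrt s) y * (1 + ?e x)"
      by (intro mult_left_mono) auto
    moreover have "normal_density 0 (sqrt s) (- y) = normal_density 0 (sqrt s) y"
      by (simp add: normal_density_def)
    ultimately show ?thesis by (simp add: g_def algebra_simps)
  qed
  have "2 * ?I = (\<integral>\<^sup>+y. ennreal (g y) \<partial>lborel) + (\<integral>\<^sup>+y. ennreal (g (- y)) \<partial>lborel)"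
    using sym by (simp add: g_def mult_2)
  also have "\<dots> = (\<integral>\<^sup>+y. ennreal (g y + g (- y)) \<partial>lborel)"
    by (subst nn_integral_add[symmetric]) (auto simp: g_nonneg)
  also have "\<dots> \<le> (\<integral>\<^sup>+y. ennreal (2 * ?B) * ennreal (normal_density 0 (sqrt s) y) \<partial>lborel)"
    using pw by (intro nn_integral_mono) (simp add: ennreal_mult[symmetric] add_nonneg_nonneg)
  also have "\<dots> = ennreal (2 * ?B)"
    using assms by (subst nn_integral_cmult) (auto simp: nn_integral_normal_density)
  finally have "2 * ?I \<le> 2 * ennreal ?B"
    by (subst (asm) ennreal_mult) (auto simp: add_nonneg_nonneg)
  then show ?thesis
    by (subst (asm) ennreal_mult_le_mult_iff) auto
qed

text \<open>\<open>\<bar>x + y\<bar> powr \<alpha>\<close> is at least a quarter of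
  \<open>\<bar>x\<bar> powr \<alpha>\<close> minus \<open>\<bar>y\<bar> powr \<alpha>\<close>, and
  as \<open>h * \<mu> \<le> 1/4\<close> and \<open>s \<le> 1\<close> the error costs at most 1/4
  plus half of the Gaussian exponent. The factor 2 covers \<open>exp (1/4) * sqrt 2\<close>. It
  makes the bound useful only far from the origin, where the symmetrised bound, never below 1/2, is
  too weak.\<close>

lemma gaussian_damping_large:
  fixes x \<alpha> \<mu> :: real
  assumes "0 < \<alpha>" "\<alpha> \<le> 2" "0 < \<mu>" "\<mu> \<le> 1/4" "0 < s" "s \<le> 1" "0 < h" "h \<le> 1"
  shows "(\<integral>\<^sup>+y. ennreal (normal_density 0 (sqrt s) y * exp (- (h * \<mu> * \<bar>x + y\<bar> powr \<alpha>))) \<partial>lborel)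
     \<le> ennreal (2 * exp (- (\<mu> / 4 * (h * \<bar>x\<bar> powr \<alpha>))))"
proof -
  define A where "A = exp (1/4) * exp (- (\<mu> / 4 * (h * \<bar>x\<bar> powr \<alpha>)))"
  have pw: "exp (- (h * \<mu> * \<bar>x + y\<bar> powr \<alpha>)) \<le> A * exp (y\<^sup>2 / (4 * s))" for y
  proof -
    have "\<bar>x\<bar> powr \<alpha> / 4 \<le> \<bar>x + y\<bar> powr \<alpha> + \<bar>y\<bar> powr \<alpha>"
      using quarter_powr_le[OF assms(1,2), of "x + y" "- y"] by simp
    then have "h * \<mu> * (\<bar>x\<bar> powr \<alpha> / 4) \<le> h * \<mu> * (\<bar>x + y\<bar> powr \<alpha> + \<bar>y\<bar> powr \<alpha>)"
      using assms by (intro mult_left_mono) auto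
    moreover have "h * \<mu> * \<bar>y\<bar> powr \<alpha> \<le> 1/4 * (1 + y\<^sup>2)"
      using powr_exponent_le_one_plus_square[OF assms(1,2), of y] assms
        mult_mono[of h 1 \<mu> "1/4"]
      by (intro mult_mono) auto
    moreover have "1/4 * y\<^sup>2 \<le> y\<^sup>2 / (4 * s)"
      using assms mult_right_mono[of s 1 "y\<^sup>2"] by (simp add: field_simps)
    ultimately have "- (h * \<mu> * \<bar>x + y\<bar> powr \<alpha>) \<le> 1/4 + - (\<mu> / 4 * (h * \<bar>x\<bar> powr \<alpha>)) + y\<^sup>2 / (4 * s)"
      by (simp add: algebra_simps)
    then show ?thesis unfolding A_def mult_exp_exp by simp
  qed
  have A_nonneg: "0 \<le> A" by (simp add: A_def)
  have "(\<integral>\<^sup>+y. ennreal (normal_density 0 (sqrt s) y * exp (- (h * \<mu> * \<bar>x + y\<bar> powr \<alpha>))) \<partial>lborel)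
      \<le> (\<integral>\<^sup>+y. ennreal A * ennreal (normal_density 0 (sqrt s) y * exp (y\<^sup>2 / (4 * s))) \<partial>lborel)"
  proof (intro nn_integral_mono)
    fix y
    have "normal_density 0 (sqrt s) y * exp (- (h * \<mu> * \<bar>x + y\<bar> powr \<alpha>))
       \<le> normal_density 0 (sqrt s) y * (A * exp (y\<^sup>2 / (4 * s)))"
      by (intro mult_left_mono pw) auto
    then show "ennreal (normal_density 0 (sqrt s) y * exp (- (h * \<mu> * \<bar>x + y\<bar> powr \<alpha>)))
       \<le> ennreal A * ennreal (normal_density 0 (sqrt s) y * exp (y\<^sup>2 / (4 * s)))"
      using A_nonneg by (simp add: ennreal_mult[symmetric] mult_ac)
  qed
  also have "\<dots> = ennreal (A * sqrt 2)"
    using assms A_nonneg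
    by (subst nn_integral_cmult) (auto simp: nn_integral_normal_density_exp_square ennreal_mult[of A])
  also have "\<dots> \<le> ennreal (2 * exp (- (\<mu> / 4 * (h * \<bar>x\<bar> powr \<alpha>))))"
  proof (intro ennreal_leI)
    have "exp (1/4 :: real) \<le> 1 + 1/4 + (1/4)\<^sup>2"
      by (rule exp_bound) auto
    moreover have "sqrt 2 \<le> (3/2 :: real)"
      by (rule real_le_lsqrt) (auto simp: power2_eq_square)
    ultimately have "exp (1/4) * sqrt 2 \<le> (21/16) * (3/2 :: real)"
      by (intro mult_mono) (simp_all add: power2_eq_square)
    then have "exp (1/4) * sqrt 2 \<le> (2 :: real)" by simp
    then show "A * sqrt 2 \<le> 2 * exp (- (\<mu> / 4 * (h * \<bar>x\<bar> powr \<alpha>)))"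
      unfolding A_def using mult_right_mono[of "exp (1/4) * sqrt 2" 2 "exp (- (\<mu> / 4 * (h * \<bar>x\<bar> powr \<alpha>)))"]
      by (simp add: mult_ac)
  qed
  finally show ?thesis .
qed

text \<open>On a bounded range the chord of \<open>exp\<close> lies above its graph, which gives
  \<open>1 - 2 * D\<close> for \<open>exp (- (\<mu> * u))\<close>, and
  \<open>1 - D \<le> exp (- D)\<close> restores an exponential. The cut-off \<open>K\<close> is
  unavoidable, the left side being at least 1/2.\<close>

lemma half_one_plus_exp_le:
  fixes u \<mu> K :: real
  assumes "0 < \<mu>" "0 < K" "0 \<le> u" "u \<le> K"
  shows "(1 + exp (- (\<mu> * u))) / 2 \<le> exp (- ((1 - exp (- (\<mu> * K))) / (2 * K) * u))"
proof -
  define D where "D = (1 - exp (- (\<mu> * K))) / (2 * K) * u"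
  have "convex_on UNIV (\<lambda>z::real. exp z)"
    by (rule exp_convex)
  then have "exp ((1 - u / K) *\<^sub>R 0 + (u / K) *\<^sub>R (- (\<mu> * K))) \<le> (1 - u / K) * exp 0 + (u / K) * exp (- (\<mu> * K))"
    by (rule convex_onD) (use assms in \<open>auto simp: field_simps\<close>)
  moreover have "(1 - u / K) *\<^sub>R 0 + (u / K) *\<^sub>R (- (\<mu> * K)) = - (\<mu> * u)"
    using assms by simp
  ultimately have "exp (- (\<mu> * u)) \<le> 1 - (1 - exp (- (\<mu> * K))) / K * u"
    by (simp add: algebra_simps diff_divide_distrib)
  moreover have "(1 - exp (- (\<mu> * K))) / K * u = 2 * D"
    by (simp add: D_def)
  ultimately have "exp (- (\<mu> * u)) \<le> 1 - 2 * D"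
    by (simp only:)
  then have "(1 + exp (- (\<mu> * u))) / 2 \<le> 1 + - D"
    by (simp add: field_simps)
  also have "\<dots> \<le> exp (- D)"
    by (rule exp_ge_add_one_self)
  finally show ?thesis unfolding D_def .
qed

text \<open>
  The prefactor must be exactly \<open>1\<close>, because such bounds for all \<open>d\<close> coordinates will be multiplied.
\<close>

lemma gaussian_damping:
  fixes \<alpha> \<mu> :: real
  assumes "0 < \<alpha>" "\<alpha> \<le> 2" "0 < \<mu>"
  obtains c where "0 < c"
    "\<And>s h x. 0 < s \<Longrightarrow> s \<le> 1 \<Longrightarrow> 0 < h \<Longrightarrow> h \<le> 1 \<Longrightarrow>
       (\<integral>\<^sup>+y. ennreal (normal_density 0 (sqrt s) y * exp (- (h * \<mu> * \<bar>x + y\<bar> powr \<alpha>))) \<partial>lborel)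
         \<le> ennreal (exp (- (c * (h * \<bar>x\<bar> powr \<alpha>))))"
proof -
  \<comment> \<open>Lowering \<mu> only enlarges the integral, and the cap 1/4 is what the bound for
    large \<open>x\<close> asks for.\<close>
  define \<nu> where "\<nu> = min \<mu> (1/4)"
  have \<nu>: "0 < \<nu>" "\<nu> \<le> \<mu>" "\<nu> \<le> 1/4" using assms by (auto simp: \<nu>_def)
  \<comment> \<open>Beyond \<open>K\<close>, half of the rate \<open>\<nu> / 4\<close> pays for the
    prefactor 2, because \<open>\<nu> / 8 * u \<ge> ln 2\<close>; the other half is the first entry
    of the minimum \<open>c\<close>.\<close>
  define K where "K = 8 * ln 2 / \<nu>"
  have K: "0 < K" using \<nu> by (simp add: K_def)
  define c where "c = min (\<nu> / 8) ((1 - exp (- (\<nu> * K))) / (2 * K))"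
  have c: "0 < c" "c \<le> \<nu> / 8" "c \<le> (1 - exp (- (\<nu> * K))) / (2 * K)"
    using K \<nu> by (auto simp: c_def)
  show thesis
  proof (rule that[OF c(1)])
    fix s h x :: real
    assume sh: "0 < s" "s \<le> 1" "0 < h" "h \<le> 1"
    define u where "u = h * \<bar>x\<bar> powr \<alpha>"
    have u: "0 \<le> u" using sh by (simp add: u_def)
    have "(\<integral>\<^sup>+y. ennreal (normal_density 0 (sqrt s) y * exp (- (h * \<mu> * \<bar>x + y\<bar> powr \<alpha>))) \<partial>lborel)
        \<le> (\<integral>\<^sup>+y. ennreal (normal_density 0 (sqrt s) y * exp (- (h * \<nu> * \<bar>x + y\<bar> powr \<alpha>))) \<partial>lborel)" (is "_ \<le> ?I")
      using \<nu> sh by (intro nn_integral_mono ennreal_leI mult_left_mono) (auto intro!: mult_right_mono)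
    also have "?I \<le> ennreal (exp (- (c * u)))"
    proof (cases "u \<le> K")
      case True
      have "?I \<le> ennreal ((1 + exp (- (h * \<nu> * \<bar>x\<bar> powr \<alpha>))) / 2)"
        using gaussian_damping_symmetrised[of \<alpha> "h * \<nu>" s x] assms \<nu> sh by simp
      also have "\<dots> = ennreal ((1 + exp (- (\<nu> * u))) / 2)"
        by (simp add: u_def mult_ac)
      also have "\<dots> \<le> ennreal (exp (- ((1 - exp (- (\<nu> * K))) / (2 * K) * u)))"
        using half_one_plus_exp_le[OF \<nu>(1) K u True] by (rule ennreal_leI)
      also have "\<dots> \<le> ennreal (exp (- (c * u)))"
        using mult_right_mono[OF c(3) u] by (intro ennreal_leI) simp
      finally show ?thesis .
    next
      case False
      have "?I \<le> ennreal (2 * exp (- (\<nu> / 4 * u)))"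
        using gaussian_damping_large[of \<alpha> \<nu> s h x] assms \<nu> sh by (simp add: u_def)
      also have "\<dots> = ennreal (exp (ln 2 + - (\<nu> / 4 * u)))"
        by (simp only: exp_add) simp
      also have "\<dots> \<le> ennreal (exp (- (c * u)))"
      proof (intro ennreal_leI)
        have "8 * ln 2 \<le> \<nu> * u" using False \<nu> by (simp add: K_def field_simps)
        moreover have "c * u \<le> \<nu> / 8 * u" using c(2) u by (rule mult_right_mono)
        ultimately have "ln 2 + c * u \<le> \<nu> / 4 * u" by simp
        then show "exp (ln 2 + - (\<nu> / 4 * u)) \<le> exp (- (c * u))" by simp
      qed
      finally show ?thesis .
    qed
    finally show "(\<integral>\<^sup>+y. ennreal (normal_density 0 (sqrt s) y * exp (- (h * \<mu> * \<bar>x + y\<bar> powr \<alpha>))) \<partial>lborel)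
         \<le> ennreal (exp (- (c * (h * \<bar>x\<bar> powr \<alpha>))))"
      by (simp add: u_def)
  qed
qed

text \<open>The exponential is below 1 except at the origin, a null set, so its Gaussian mean is
  strictly below 1. This is the source of the exponential decay in time, wherever the path
  starts.\<close>

lemma gaussian_damping_strict:
  fixes \<alpha> \<kappa> :: real
  assumes "0 < \<kappa>"
  obtains \<delta> where "0 < \<delta>"
    "(\<integral>\<^sup>+y. ennreal (normal_density 0 1 y * exp (- (\<kappa> * \<bar>y\<bar> powr \<alpha>))) \<partial>lborel) \<le> ennreal (exp (- \<delta>))"
proof -
  define N where "N = density lborel (\<lambda>y. ennreal (normal_density 0 1 y))"
  interpret prob_space N
    unfolding N_def by (rule prob_space_normal_density) simp
  define g where "g y = exp (- (\<kappa> * \<bar>y\<bar> powr \<alpha>))" for y :: real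
  have [measurable]: "g \<in> borel_measurable borel" unfolding g_def by measurable
  have [measurable_cong]: "sets N = sets borel" by (simp add: N_def)
  have int: "integrable N g"
    using assms by (intro integrable_const_bound[of _ 1]) (auto simp: g_def)
  have "AE y in lborel. y \<noteq> (0::real)"
    by (rule AE_lborel_singleton)
  then have "AE y in N. g y < 1"
    unfolding N_def by (subst AE_density) (use assms in \<open>auto simp: g_def elim!: eventually_mono\<close>)
  then have less: "expectation g < 1"
    by (rule expectation_less[OF int])
  have eq: "(\<integral>\<^sup>+y. ennreal (normal_density 0 1 y * exp (- (\<kappa> * \<bar>y\<bar> powr \<alpha>))) \<partial>lborel) = ennreal (expectation g)"
  proof -
    have "(\<integral>\<^sup>+y. ennreal (normal_density 0 1 y * exp (- (\<kappa> * \<bar>y\<bar> powr \<alpha>))) \<partial>lborel) = (\<integral>\<^sup>+y. ennreal (g y) \<partial>N)"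
      unfolding N_def by (subst nn_integral_density) (auto simp: g_def ennreal_mult)
    also have "\<dots> = ennreal (expectation g)"
      by (intro nn_integral_eq_integral int) (simp add: g_def)
    finally show ?thesis .
  qed
  \<comment> \<open>The maximum with 1/2 secures a positive argument for the logarithm.\<close>
  define q where "q = max (1/2) (expectation g)"
  have q: "0 < q" "q < 1" "expectation g \<le> q"
    using less by (auto simp: q_def)
  show thesis
    by (rule that[of "- ln q"]) (use q eq in \<open>auto intro: ennreal_leI\<close>)
qed

section \<open>Path space and uniqueness of Wiener measure\<close>

lemma space_Rd: "space (Rd d) = (\<Pi>\<^sub>E i\<in>{..<d}. UNIV)"
  by (simp add: Rd_def space_PiM)

lemma measurable_Rd_component:
  assumes "g \<in> measurable N (Rd d)" "i < d"
  shows "(\<lambda>z. g z i) \<in> borel_measurable N"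
proof -
  have "(\<lambda>x. x i) \<in> borel_measurable (Rd d)"
    unfolding Rd_def using assms(2) measurable_component_singleton[of i "{..<d}" "\<lambda>_. lborel"] by simp
  from measurable_compose[OF assms(1) this] show ?thesis .
qed

lemma measurable_Rd_I:
  assumes "\<And>i. i < d \<Longrightarrow> (\<lambda>z. g z i) \<in> borel_measurable N"
  shows "(\<lambda>z. \<lambda>i\<in>{..<d}. g z i) \<in> measurable N (Rd d)"
  unfolding Rd_def using assms by (intro measurable_restrict) simp

lemma path_space_continuous: "\<omega> \<in> space (path_space d) \<Longrightarrow> i < d \<Longrightarrow> continuous_on {0..} (\<lambda>s. \<omega> s i)"
  by (simp add: path_space_def space_restrict_space)

lemma path_space_in_Rd: "\<omega> \<in> space (path_space d) \<Longrightarrow> 0 \<le> s \<Longrightarrow> \<omega> s \<in> space (Rd d)"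
  by (auto simp: path_space_def space_restrict_space space_PiM)

lemma measurable_path_eval:
  assumes "0 \<le> s"
  shows "(\<lambda>\<omega>. \<omega> s) \<in> measurable (path_space d) (Rd d)"
  unfolding path_space_def using assms
  by (intro measurable_restrict_space1 measurable_component_singleton) simp

lemma measurable_path_coordinate:
  assumes "0 \<le> s" "i < d"
  shows "(\<lambda>\<omega>. \<omega> s i) \<in> borel_measurable (path_space d)"
  using measurable_Rd_component[OF measurable_path_eval[OF assms(1)] assms(2)] .

text \<open>Continuity makes the process the limit of its values at the last grid time up to
  \<open>s\<close>, and each such approximation is a countable case distinction over evaluations at
  fixed times. The \<open>max 0\<close> lets the time run over all of \<open>borel\<close>, although
  paths carry information only at non-negative times.\<close>

lemma measurable_path_joint:
  assumes "i < d"
  shows "(\<lambda>(s, \<omega>). \<omega> (max 0 s) i) \<in> borel_measurable (borel \<Otimes>\<^sub>M path_space d)"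
proof (rule borel_measurable_LIMSEQ_metric)
  define f where "f n = (\<lambda>(s, \<omega>). \<omega> (real (nat \<lfloor>max 0 s * real (Suc n)\<rfloor>) / real (Suc n)) i :: real)"
    for n :: nat
  show "f n \<in> borel_measurable (borel \<Otimes>\<^sub>M path_space d)" for n
  proof -
    have [measurable]: "(\<lambda>z. snd z (real k / real (Suc n)) i) \<in> borel_measurable (borel \<Otimes>\<^sub>M path_space d)" for k
      using measurable_compose[OF measurable_snd measurable_path_coordinate[of "real k / real (Suc n)", OF _ assms]]
      by (simp del: of_nat_Suc)
    have "(\<lambda>z. snd z (real (nat \<lfloor>max 0 (fst z) * real (Suc n)\<rfloor>) / real (Suc n)) i)
        \<in> borel_measurable (borel \<Otimes>\<^sub>M path_space d)"
      by (rule measurable_compose_countable[where f = "\<lambda>k z. snd z (real k / real (Suc n)) i"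
            and g = "\<lambda>z. nat \<lfloor>max 0 (fst z) * real (Suc n)\<rfloor>"]) measurable
    then show ?thesis by (simp add: f_def case_prod_beta')
  qed
  show "(\<lambda>n. f n z) \<longlonglongrightarrow> (case z of (s, \<omega>) \<Rightarrow> \<omega> (max 0 s) i)"
    if "z \<in> space (borel \<Otimes>\<^sub>M path_space d)" for z
  proof -
    obtain s \<omega> where z: "z = (s, \<omega>)" by (cases z)
    then have cont: "continuous_on {0..} (\<lambda>s. \<omega> s i)"
      using that assms path_space_continuous by (auto simp: space_pair_measure)
    have "(\<lambda>n. of_int \<lfloor>max 0 s * real (Suc n)\<rfloor> / real (Suc n)) \<longlonglongrightarrow> max 0 s"
    proof (rule tendsto_sandwich[of "\<lambda>n. max 0 s - 1 / real (Suc n)" _ _ "\<lambda>_. max 0 s"])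
      show "\<forall>\<^sub>F n in sequentially. max 0 s - 1 / real (Suc n) \<le> of_int \<lfloor>max 0 s * real (Suc n)\<rfloor> / real (Suc n)"
      proof (intro always_eventually allI)
        fix n
        have "max 0 s * real (Suc n) - 1 \<le> of_int \<lfloor>max 0 s * real (Suc n)\<rfloor>" by linarith
        then have "(max 0 s * real (Suc n) - 1) / real (Suc n) \<le> of_int \<lfloor>max 0 s * real (Suc n)\<rfloor> / real (Suc n)"
          by (intro divide_right_mono) auto
        then show "max 0 s - 1 / real (Suc n) \<le> of_int \<lfloor>max 0 s * real (Suc n)\<rfloor> / real (Suc n)"
          by (simp add: diff_divide_distrib del: of_nat_Suc)
      qed
      show "\<forall>\<^sub>F n in sequentially. of_int \<lfloor>max 0 s * real (Suc n)\<rfloor> / real (Suc n) \<le> max 0 s"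
      proof (intro always_eventually allI)
        fix n
        show "of_int \<lfloor>max 0 s * real (Suc n)\<rfloor> / real (Suc n) \<le> max 0 s"
          by (subst pos_divide_le_eq) (auto simp del: of_nat_Suc)
      qed
      show "(\<lambda>n. max 0 s - 1 / real (Suc n)) \<longlonglongrightarrow> max 0 s"
        using tendsto_diff[OF tendsto_const LIMSEQ_inverse_real_of_nat, of "max 0 s"]
        by (simp add: inverse_eq_divide)
    qed auto
    moreover have "of_int \<lfloor>max 0 s * real (Suc n)\<rfloor> / real (Suc n)
        = real (nat \<lfloor>max 0 s * real (Suc n)\<rfloor>) / real (Suc n)" for n
      by (simp del: of_nat_Suc)
    ultimately have "(\<lambda>n. real (nat \<lfloor>max 0 s * real (Suc n)\<rfloor>) / real (Suc n)) \<longlonglongrightarrow> max 0 s"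
      by simp
    then have "(\<lambda>n. \<omega> (real (nat \<lfloor>max 0 s * real (Suc n)\<rfloor>) / real (Suc n)) i) \<longlonglongrightarrow> \<omega> (max 0 s) i"
      by (intro continuous_on_tendsto_compose[OF cont]) auto
    then show ?thesis by (simp add: z f_def)
  qed
qed

section \<open>Translation of paths\<close>

text \<open>The restriction makes the sum extensional again, as membership in the product space
  demands.\<close>

definition shifted :: "nat \<Rightarrow> (nat \<Rightarrow> real) \<Rightarrow> (nat \<Rightarrow> real) \<Rightarrow> (nat \<Rightarrow> real)" where
  "shifted d y z = (\<lambda>i\<in>{..<d}. y i + z i)"

lemma shifted_in_Rd: "shifted d y z \<in> space (Rd d)"
  by (auto simp: shifted_def space_Rd)

lemma measurable_shifted_path [measurable (raw)]:
  assumes [measurable]: "y \<in> measurable N (Rd d)" "w \<in> measurable N (path_space d)" "g \<in> borel_measurable N"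
  shows "(\<lambda>z. shifted d (y z) (w z (max 0 (g z)))) \<in> measurable N (Rd d)"
proof -
  have "(\<lambda>z. w z (max 0 (g z)) i) \<in> borel_measurable N" if "i < d" for i
    using measurable_compose[OF measurable_Pair[OF assms(3,2)] measurable_path_joint[OF that]] by simp
  then show ?thesis
    unfolding shifted_def
    by (intro measurable_Rd_I borel_measurable_add measurable_Rd_component[OF assms(1)])
qed

definition shifted_path :: "nat \<Rightarrow> (nat \<Rightarrow> real) \<Rightarrow> (real \<Rightarrow> nat \<Rightarrow> real) \<Rightarrow> (real \<Rightarrow> nat \<Rightarrow> real)" where
  "shifted_path d x \<omega> = (\<lambda>s\<in>{0..}. shifted d x (\<omega> s))"

lemma measurable_shifted_path_map:
  "shifted_path d x \<in> measurable (path_space d) (path_space d)"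
proof -
  have coord: "(\<lambda>\<omega>. shifted d x (\<omega> s)) \<in> measurable (path_space d) (Rd d)" if "0 \<le> s" for s
    unfolding shifted_def
    by (intro measurable_Rd_I borel_measurable_add borel_measurable_const measurable_path_coordinate that)
  have "shifted_path d x \<in> measurable (path_space d) (\<Pi>\<^sub>M s\<in>{0..}. Rd d)"
    unfolding shifted_path_def by (intro measurable_restrict coord) simp
  moreover have "continuous_on {0..} (\<lambda>s. shifted_path d x \<omega> s i)"
    if "\<omega> \<in> space (path_space d)" "i < d" for \<omega> i
  proof (rule continuous_on_eq)
    show "continuous_on {0..} (\<lambda>s. x i + \<omega> s i)"
      by (intro continuous_intros path_space_continuous[OF that])
  qed (use that in \<open>auto simp: shifted_path_def shifted_def\<close>)
  ultimately show ?thesis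
    unfolding path_space_def[of d]
    by (intro measurable_restrict_space2) (auto simp flip: path_space_def)
qed

text \<open>Finite-dimensional distributions determine a finite measure on the full product. The
  continuous paths need not form a measurable set there, so both measures are pushed forward along
  the inclusion; an event of the path space is the trace of a product event, hence its
  preimage.\<close>

lemma path_measure_eqI:
  assumes P: "finite_measure P" "sets P = sets (path_space d)" and Q: "sets Q = sets (path_space d)"
    and eq: "\<And>J A. finite J \<Longrightarrow> J \<subseteq> {0..} \<Longrightarrow> (\<And>s. s \<in> J \<Longrightarrow> A s \<in> sets (Rd d)) \<Longrightarrow>
      emeasure P {\<omega> \<in> space P. \<forall>s\<in>J. \<omega> s \<in> A s} = emeasure Q {\<omega> \<in> space Q. \<forall>s\<in>J. \<omega> s \<in> A s}"
  shows "P = Q"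
proof -
  let ?M = "\<Pi>\<^sub>M s\<in>{0..}. Rd d"
  have sp: "space P = space (path_space d)" "space Q = space (path_space d)"
    using P(2) Q by (auto dest: sets_eq_imp_space_eq)
  have id: "(\<lambda>\<omega>. \<omega>) \<in> measurable (path_space d) ?M"
    unfolding path_space_def by (intro measurable_restrict_space1) simp
  have idP: "(\<lambda>\<omega>. \<omega>) \<in> measurable P ?M" and idQ: "(\<lambda>\<omega>. \<omega>) \<in> measurable Q ?M"
    using id measurable_cong_sets[OF P(2) refl, of ?M] measurable_cong_sets[OF Q refl, of ?M] by auto
  have *: "distr P ?M (\<lambda>\<omega>. \<omega>) = distr Q ?M (\<lambda>\<omega>. \<omega>)"
  proof (rule measure_eqI_PiM_infinite)
    fix A and J :: "real set"
    assume J: "finite J" "J \<subseteq> {0..}" and A: "\<And>s. s \<in> J \<Longrightarrow> A s \<in> sets (Rd d)"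
    let ?E = "prod_emb {0..} (\<lambda>_. Rd d) J (Pi\<^sub>E J A)"
    have E: "?E \<in> sets ?M"
      using J A by (intro sets_PiM_I) auto
    have vi: "?E \<inter> space (path_space d) = {\<omega> \<in> space (path_space d). \<forall>s\<in>J. \<omega> s \<in> A s}"
      by (auto simp: prod_emb_def path_space_def space_restrict_space space_PiM PiE_iff restrict_def extensional_def)
    show "emeasure (distr P ?M (\<lambda>\<omega>. \<omega>)) ?E = emeasure (distr Q ?M (\<lambda>\<omega>. \<omega>)) ?E"
      using eq[OF J A] by (simp add: emeasure_distr[OF idP E] emeasure_distr[OF idQ E] sp vi)
  next
    show "finite_measure (distr P ?M (\<lambda>\<omega>. \<omega>))"
      using finite_measure.finite_measure_distr[OF P(1) idP] .
  qed auto
  show ?thesis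
  proof (rule measure_eqI)
    show "sets P = sets Q" using P(2) Q by simp
    fix A assume "A \<in> sets P"
    then have "A \<in> sets (path_space d)"
      using P(2) by simp
    then obtain B where B: "B \<in> sets ?M" "A = {\<omega>. \<forall>i<d. continuous_on {0..} (\<lambda>s. \<omega> s i)} \<inter> B"
      unfolding path_space_def sets_restrict_space by blast
    then have "A = space (path_space d) \<inter> B"
      using sets.sets_into_space[OF B(1)] by (auto simp: path_space_def space_restrict_space)
    note B = B(1) this
    have "emeasure P A = emeasure (distr P ?M (\<lambda>\<omega>. \<omega>)) B"
      using B by (simp add: emeasure_distr[OF idP] sp Int_commute)
    also have "\<dots> = emeasure Q A"
      unfolding * using B by (simp add: emeasure_distr[OF idQ] sp Int_commute)
    finally show "emeasure P A = emeasure Q A" .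
  qed
qed

section \<open>Finite-dimensional distributions and uniqueness in law\<close>

lemma wiener_measureD:
  assumes "wiener_measure d x P"
  shows "prob_space P" "sets P = sets (path_space d)" "space P = space (path_space d)"
    "AE \<omega> in P. \<omega> 0 = x"
    "\<And>s t i. 0 \<le> s \<Longrightarrow> s < t \<Longrightarrow> i < d \<Longrightarrow> distributed P lborel (\<lambda>\<omega>. \<omega> t i - \<omega> s i)
          (\<lambda>y. ennreal (normal_density 0 (sqrt (t - s)) y))"
    "\<And>n t. 0 \<le> t 0 \<Longrightarrow> (\<And>k. k < n \<Longrightarrow> t k < t (Suc k)) \<Longrightarrow>
        prob_space.indep_vars P (\<lambda>_. borel)
          (\<lambda>(k, i) \<omega>. \<omega> (t (Suc k)) i - \<omega> (t k) i) ({..<n} \<times> {..<d})"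
proof -
  show s: "sets P = sets (path_space d)"
    using assms by (simp add: wiener_measure_def)
  show "space P = space (path_space d)"
    using sets_eq_imp_space_eq[OF s] .
qed (use assms in \<open>auto simp: wiener_measure_def\<close>)

lemma Collect_mem_in_sets:
  assumes "g \<in> measurable M N" "A \<in> sets N"
  shows "{z \<in> space M. g z \<in> A} \<in> sets M"
  using measurable_sets[OF assms] by (simp add: vimage_def Int_def conj_commute)

lemma times_nonneg:
  fixes t :: "nat \<Rightarrow> real"
  assumes "t 0 = 0" "\<And>k. k < n \<Longrightarrow> t k < t (Suc k)" "k \<le> n"
  shows "0 \<le> t k"
  using assms(3)
proof (induction k)
  case (Suc k)
  then show ?case using assms(2)[of k] by simp
qed (simp add: assms(1))

text \<open>Independence jointly over steps and coordinates amounts to a product law, with the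
  marginals prescribed by the definition. \<open>0 < n\<close> and \<open>0 < d\<close> keep the
  index set nonempty for that equivalence.\<close>

lemma wiener_increments_distr:
  assumes W: "wiener_measure d x P" and t: "t 0 = 0" "\<And>k. k < n \<Longrightarrow> t k < t (Suc k)"
    and nd: "0 < n" "0 < d"
  shows "distr P (\<Pi>\<^sub>M ki\<in>{..<n}\<times>{..<d}. borel) (\<lambda>\<omega>. \<lambda>(k, i)\<in>{..<n}\<times>{..<d}. \<omega> (t (Suc k)) i - \<omega> (t k) i)
    = (\<Pi>\<^sub>M ki\<in>{..<n}\<times>{..<d}. density lborel
        (\<lambda>y. ennreal (normal_density 0 (sqrt (t (Suc (fst ki)) - t (fst ki))) y)))"
proof -
  interpret prob_space P using wiener_measureD(1)[OF W] .
  let ?X = "\<lambda>(k, i) \<omega>. \<omega> (t (Suc k)) i - \<omega> (t k) i :: real"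
  let ?I = "{..<n} \<times> {..<d}"
  have t_nonneg: "0 \<le> t k" if "k \<le> n" for k
    using times_nonneg[OF t that] .
  have D: "distributed P lborel (?X ki) (\<lambda>y. ennreal (normal_density 0 (sqrt (t (Suc (fst ki)) - t (fst ki))) y))"
    if "ki \<in> ?I" for ki
    using wiener_measureD(5)[OF W t_nonneg[of "fst ki"] t(2)[of "fst ki"], of "snd ki"] that
    by (auto simp: case_prod_beta)
  have X: "?X ki \<in> borel_measurable P" if "ki \<in> ?I" for ki
    using distributed_measurable[OF D[OF that]] by simp
  have ind: "indep_vars (\<lambda>_. borel) ?X ?I"
    using t by (intro wiener_measureD(6)[OF W]) auto
  have "?I \<noteq> {}" using nd by auto
  then have "distr P (\<Pi>\<^sub>M ki\<in>?I. borel) (\<lambda>\<omega>. \<lambda>ki\<in>?I. ?X ki \<omega>) = (\<Pi>\<^sub>M ki\<in>?I. distr P borel (?X ki))"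
    using ind X by (subst indep_vars_iff_distr_eq_PiM'[symmetric]) auto
  also have "\<dots> = (\<Pi>\<^sub>M ki\<in>?I. density lborel
        (\<lambda>y. ennreal (normal_density 0 (sqrt (t (Suc (fst ki)) - t (fst ki))) y)))"
  proof (intro PiM_cong refl)
    fix ki assume "ki \<in> ?I"
    from distributed_distr_eq_density[OF D[OF this]]
    show "distr P borel (?X ki) = density lborel
        (\<lambda>y. ennreal (normal_density 0 (sqrt (t (Suc (fst ki)) - t (fst ki))) y))"
      by (simp cong: distr_cong)
  qed
  finally show ?thesis
    by (simp add: case_prod_beta')
qed

text \<open>Positions are the start plus partial sums of increments, whose law does not involve the
  start. On the right \<open>x\<close> enters only through \<open>y i + x i\<close>, so starting at
  \<open>x\<close> unshifted and starting at the origin shifted by \<open>x\<close> give the same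
  probability.\<close>

lemma wiener_cylinder_probability:
  assumes W: "wiener_measure d x P" and t: "t 0 = 0" "\<And>k. k < n \<Longrightarrow> t k < t (Suc k)"
    and nd: "0 < n" "0 < d" and A: "\<And>k. k \<le> n \<Longrightarrow> A k \<in> sets (Rd d)"
  shows "emeasure P {\<omega> \<in> space P. \<forall>k\<le>n. shifted d y (\<omega> (t k)) \<in> A k}
    = emeasure (\<Pi>\<^sub>M ki\<in>{..<n}\<times>{..<d}. density lborel
        (\<lambda>y. ennreal (normal_density 0 (sqrt (t (Suc (fst ki)) - t (fst ki))) y)))
        {\<delta> \<in> space (\<Pi>\<^sub>M ki\<in>{..<n}\<times>{..<d}. borel).
          \<forall>k\<le>n. (\<lambda>i\<in>{..<d}. (y i + x i) + (\<Sum>j<k. \<delta> (j, i))) \<in> A k}"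
    (is "emeasure P ?E = emeasure ?N ?B")
proof -
  interpret prob_space P using wiener_measureD(1)[OF W] .
  let ?I = "{..<n} \<times> {..<d}"
  let ?D = "\<lambda>\<omega>. \<lambda>(k, i)\<in>?I. \<omega> (t (Suc k)) i - \<omega> (t k) i :: real"
  note sP [measurable_cong] = wiener_measureD(2)[OF W]
  have t_nonneg: "0 \<le> t k" if "k \<le> n" for k
    using times_nonneg[OF t that] .
  have coord: "(\<lambda>\<omega>. \<omega> (t k) i) \<in> borel_measurable P" if "k \<le> n" "i < d" for k i
    using measurable_path_coordinate[OF t_nonneg that(2)] that(1) by simp
  have D: "?D \<in> measurable P (\<Pi>\<^sub>M ki\<in>?I. borel)"
    by (intro measurable_restrict) (auto intro!: borel_measurable_diff coord)
  have S: "(\<lambda>\<delta>. \<lambda>i\<in>{..<d}. (y i + x i) + (\<Sum>j<k. \<delta> (j, i))) \<in> measurable (\<Pi>\<^sub>M ki\<in>?I. borel) (Rd d)"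
    if "k \<le> n" for k
    using that
    by (intro measurable_Rd_I borel_measurable_add borel_measurable_sum borel_measurable_const
        measurable_component_singleton) auto
  have B: "?B \<in> sets (\<Pi>\<^sub>M ki\<in>?I. borel)"
  proof -
    have "{\<delta> \<in> space (\<Pi>\<^sub>M ki\<in>?I. borel). \<forall>k\<in>{..n}. (\<lambda>i\<in>{..<d}. (y i + x i) + (\<Sum>j<k. \<delta> (j, i))) \<in> A k}
       \<in> sets (\<Pi>\<^sub>M ki\<in>?I. borel)"
    proof (intro sets.sets_Collect_finite_All)
      fix k assume "k \<in> {..n}"
      then have k: "k \<le> n" by simp
      show "{\<delta> \<in> space (\<Pi>\<^sub>M ki\<in>?I. borel). (\<lambda>i\<in>{..<d}. (y i + x i) + (\<Sum>j<k. \<delta> (j, i))) \<in> A k}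
         \<in> sets (\<Pi>\<^sub>M ki\<in>?I. borel)"
        by (rule Collect_mem_in_sets[OF S[OF k] A[OF k]])
    qed simp
    then show ?thesis by (simp only: Ball_def atMost_iff)
  qed
  \<comment> \<open>The two events may differ on paths that do not start at \<open>x\<close>, hence
    only almost sure equality.\<close>
  have "AE \<omega> in P. \<omega> \<in> ?E \<longleftrightarrow> \<omega> \<in> ?D -` ?B \<inter> space P"
    using wiener_measureD(4)[OF W] AE_space
  proof eventually_elim
    case (elim \<omega>)
    have "shifted d y (\<omega> (t k)) = (\<lambda>i\<in>{..<d}. (y i + x i) + (\<Sum>j<k. ?D \<omega> (j, i)))" if "k \<le> n" for k
    proof -
      have "(\<Sum>j<k. ?D \<omega> (j, i)) = \<omega> (t k) i - \<omega> (t 0) i" if "i < d" for i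
        using that \<open>k \<le> n\<close> by (subst sum_lessThan_telescope[symmetric]) (auto intro!: sum.cong)
      then show ?thesis
        using elim t(1) by (auto simp: shifted_def fun_eq_iff)
    qed
    moreover have "?D \<omega> \<in> space (\<Pi>\<^sub>M ki\<in>?I. borel)"
      using measurable_space[OF D elim(2)] .
    ultimately show ?case
      using elim(2) by auto
  qed
  moreover have "?E \<in> sets P"
  proof -
    have "{\<omega> \<in> space P. shifted d y (\<omega> (t k)) \<in> A k} \<in> sets P" if "k \<le> n" for k
    proof (rule Collect_mem_in_sets[OF _ A[OF that]])
      show "(\<lambda>\<omega>. shifted d y (\<omega> (t k))) \<in> measurable P (Rd d)"
        unfolding shifted_def using that
        by (intro measurable_Rd_I borel_measurable_add borel_measurable_const coord)
    qed
    then have "{\<omega> \<in> space P. \<forall>k\<in>{..n}. shifted d y (\<omega> (t k)) \<in> A k} \<in> sets P"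
      by (intro sets.sets_Collect_finite_All) auto
    then show ?thesis by (simp only: Ball_def atMost_iff)
  qed
  ultimately have "emeasure P ?E = emeasure P (?D -` ?B \<inter> space P)"
    by (intro emeasure_eq_AE measurable_sets[OF D B])
  also have "\<dots> = emeasure (distr P (\<Pi>\<^sub>M ki\<in>?I. borel) ?D) ?B"
    by (rule emeasure_distr[OF D B, symmetric])
  also have "\<dots> = emeasure ?N ?B"
    by (subst wiener_increments_distr[OF W t nd]) auto
  finally show ?thesis .
qed

lemma finite_times_enumeration:
  assumes "finite J" "J \<subseteq> {0::real..}"
  obtains t :: "nat \<Rightarrow> real" and n where "t 0 = 0" "0 < n" "\<And>k. k < n \<Longrightarrow> t k < t (Suc k)" "J \<subseteq> t ` {..n}"
proof -
  \<comment> \<open>Time 0 is the base point of the increments; time 1 guarantees at least one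
    increment even for empty \<open>J\<close>.\<close>
  define F where "F = J \<union> {0, 1}"
  have F: "finite F" "0 \<in> F" "1 \<in> F" "\<And>s. s \<in> F \<Longrightarrow> 0 \<le> s" using assms by (auto simp: F_def)
  define t where "t k = sorted_list_of_set F ! k" for k
  define n where "n = card F - 1"
  have "card {0, 1::real} \<le> card F"
    using F by (intro card_mono) auto
  then have n: "0 < n" "card F = Suc n" by (auto simp: n_def)
  have len: "length (sorted_list_of_set F) = Suc n"
    using n F by simp
  have im: "t ` {..n} = F"
  proof -
    have "set (sorted_list_of_set F) = (\<lambda>k. sorted_list_of_set F ! k) ` {..<Suc n}"
      using len by (metis atLeast0LessThan list.set_map map_nth set_upt)
    then show ?thesis using F by (simp add: t_def[abs_def] lessThan_Suc_atMost)
  qed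
  have mono: "t j < t k" if "j < k" "k \<le> n" for j k
    unfolding t_def using that len strict_sorted_list_of_set[of F]
    by (auto intro: sorted_wrt_nth_less)
  have "t 0 = 0"
  proof -
    obtain k where k: "k \<le> n" "t k = 0" using im F(2) by (metis atMost_iff imageE)
    have "0 \<le> t 0" using im F(4) by auto
    with k mono[of 0 k] show ?thesis by (cases "k = 0") auto
  qed
  then show thesis
    using that[of t n] n mono im by (auto simp: F_def)
qed

text \<open>
  The family \<open>W\<close> in the theorem is arbitrary, so this is what makes \<open>x \<mapsto> semigroup_L W V t f x\<close> measurable.
\<close>

lemma wiener_measure_shift:
  assumes P: "wiener_measure d x P" and Q: "wiener_measure d (\<lambda>i\<in>{..<d}. 0) Q" and d: "0 < d"
    and x: "x \<in> space (Rd d)"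
  shows "P = distr Q (path_space d) (shifted_path d x)"
proof (rule path_measure_eqI)
  note sQ = wiener_measureD(2,3)[OF Q]
  have SQ: "shifted_path d x \<in> measurable Q (path_space d)"
    using measurable_shifted_path_map measurable_cong_sets[OF sQ(1) refl] by blast
  show "finite_measure P" using prob_space.finite_measure[OF wiener_measureD(1)[OF P]] .
  show "sets P = sets (path_space d)" using wiener_measureD(2)[OF P] .
  fix J :: "real set" and A
  assume J: "finite J" "J \<subseteq> {0..}" and A: "\<And>s. s \<in> J \<Longrightarrow> A s \<in> sets (Rd d)"
  obtain t n where t: "t 0 = 0" "\<And>k. k < n \<Longrightarrow> t k < t (Suc k)" and n: "0 < n" and Jt: "J \<subseteq> t ` {..n}"
    using finite_times_enumeration[OF J] by metis
  have t_nonneg: "0 \<le> t k" if "k \<le> n" for k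
    using times_nonneg[OF t that] .
  \<comment> \<open>Grid times that were added to \<open>J\<close> impose no constraint.\<close>
  define A' where "A' k = (if t k \<in> J then A (t k) else space (Rd d))" for k
  have A': "A' k \<in> sets (Rd d)" for k using A by (auto simp: A'_def)
  have ext: "(\<forall>s\<in>J. w s \<in> A s) \<longleftrightarrow> (\<forall>k\<le>n. w (t k) \<in> A' k)"
    if "\<And>k. k \<le> n \<Longrightarrow> w (t k) \<in> space (Rd d)" for w
    using that Jt by (fastforce simp: A'_def)
  let ?o = "\<lambda>i. 0 :: real"
  have "{\<omega> \<in> space P. \<forall>s\<in>J. \<omega> s \<in> A s} = {\<omega> \<in> space P. \<forall>k\<le>n. shifted d ?o (\<omega> (t k)) \<in> A' k}"
  proof (intro Collect_cong conj_cong refl)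
    fix \<omega> assume "\<omega> \<in> space P"
    then have w: "\<omega> (t k) \<in> space (Rd d)" if "k \<le> n" for k
      using path_space_in_Rd t_nonneg[OF that] by (simp add: wiener_measureD(3)[OF P])
    have "shifted d ?o (\<omega> (t k)) = \<omega> (t k)" if "k \<le> n" for k
      using w[OF that] by (auto simp: shifted_def space_Rd PiE_iff extensional_restrict)
    then show "(\<forall>s\<in>J. \<omega> s \<in> A s) = (\<forall>k\<le>n. shifted d ?o (\<omega> (t k)) \<in> A' k)"
      using ext[of \<omega>] w by simp
  qed
  moreover have "emeasure (distr Q (path_space d) (shifted_path d x)) {\<omega> \<in> space (path_space d). \<forall>s\<in>J. \<omega> s \<in> A s}
     = emeasure Q {\<omega> \<in> space Q. \<forall>k\<le>n. shifted d x (\<omega> (t k)) \<in> A' k}"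
  proof (subst emeasure_distr[OF SQ])
    show "{\<omega> \<in> space (path_space d). \<forall>s\<in>J. \<omega> s \<in> A s} \<in> sets (path_space d)"
    proof -
      have "{\<omega> \<in> space (path_space d). \<omega> s \<in> A s} \<in> sets (path_space d)" if "s \<in> J" for s
        using that J by (intro Collect_mem_in_sets[OF measurable_path_eval A[OF that]]) auto
      then show ?thesis using J(1) by (intro sets.sets_Collect_finite_All) auto
    qed
    have "shifted_path d x \<omega> (t k) = shifted d x (\<omega> (t k))" if "k \<le> n" for k \<omega>
      using t_nonneg[OF that] by (simp add: shifted_path_def)
    then have "shifted_path d x -` {\<omega> \<in> space (path_space d). \<forall>s\<in>J. \<omega> s \<in> A s} \<inter> space Q
        = {\<omega> \<in> space Q. \<forall>k\<le>n. shifted d x (\<omega> (t k)) \<in> A' k}"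
      using ext[of "shifted_path d x _"] measurable_space[OF SQ]
      by (auto simp: shifted_in_Rd)
    then show "emeasure Q (shifted_path d x -` {\<omega> \<in> space (path_space d). \<forall>s\<in>J. \<omega> s \<in> A s} \<inter> space Q)
        = emeasure Q {\<omega> \<in> space Q. \<forall>k\<le>n. shifted d x (\<omega> (t k)) \<in> A' k}"
      by simp
  qed
  moreover have "emeasure P {\<omega> \<in> space P. \<forall>k\<le>n. shifted d ?o (\<omega> (t k)) \<in> A' k}
     = emeasure Q {\<omega> \<in> space Q. \<forall>k\<le>n. shifted d x (\<omega> (t k)) \<in> A' k}"
    using wiener_cylinder_probability[OF P t n d A', of ?o] wiener_cylinder_probability[OF Q t n d A', of x]
    by (simp cong: restrict_cong)
  ultimately show "emeasure P {\<omega> \<in> space P. \<forall>s\<in>J. \<omega> s \<in> A s}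
     = emeasure (distr Q (path_space d) (shifted_path d x))
        {\<omega> \<in> space (distr Q (path_space d) (shifted_path d x)). \<forall>s\<in>J. \<omega> s \<in> A s}"
    by simp
qed simp

section \<open>The Feynman--Kac formula\<close>

lemma PiM_density:
  fixes g :: "'i \<Rightarrow> real \<Rightarrow> ennreal"
  assumes I: "finite I" and g: "\<And>i. i \<in> I \<Longrightarrow> g i \<in> borel_measurable borel"
    and p: "\<And>i. prob_space (density lborel (g i))"
  shows "(\<Pi>\<^sub>M i\<in>I. density lborel (g i)) = density (\<Pi>\<^sub>M i\<in>I. lborel) (\<lambda>x. \<Prod>i\<in>I. g i (x i))"
proof (rule sym, rule product_sigma_finite.PiM_eqI)
  interpret P: prob_space "density lborel (g i)" for i using p .
  show "product_sigma_finite (\<lambda>i. density lborel (g i))" ..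
  interpret L: product_sigma_finite "\<lambda>_. lborel :: real measure" ..
  show "finite I" by fact
  show "sets (density (\<Pi>\<^sub>M i\<in>I. lborel) (\<lambda>x. \<Prod>i\<in>I. g i (x i)))
      = sets (\<Pi>\<^sub>M i\<in>I. density lborel (g i))"
    by (simp cong: sets_PiM_cong)
  fix A :: "'i \<Rightarrow> real set" assume "\<And>i. i \<in> I \<Longrightarrow> A i \<in> sets (density lborel (g i))"
  then have A: "\<And>i. i \<in> I \<Longrightarrow> A i \<in> sets borel" by simp
  have meas: "(\<lambda>x. \<Prod>i\<in>I. g i (x i)) \<in> borel_measurable (\<Pi>\<^sub>M i\<in>I. lborel)"
    by (intro borel_measurable_prod_ennreal measurable_compose[OF measurable_component_singleton]) (auto intro: g)
  have "emeasure (density (\<Pi>\<^sub>M i\<in>I. lborel) (\<lambda>x. \<Prod>i\<in>I. g i (x i))) (Pi\<^sub>E I A)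
     = (\<integral>\<^sup>+x. (\<Prod>i\<in>I. g i (x i)) * indicator (Pi\<^sub>E I A) x \<partial>(\<Pi>\<^sub>M i\<in>I. lborel))"
    using A by (intro emeasure_density meas sets_PiM_I_finite I) auto
  also have "\<dots> = (\<integral>\<^sup>+x. (\<Prod>i\<in>I. g i (x i) * indicator (A i) (x i)) \<partial>(\<Pi>\<^sub>M i\<in>I. lborel))"
  proof (intro nn_integral_cong)
    fix x :: "'i \<Rightarrow> real" assume "x \<in> space (\<Pi>\<^sub>M i\<in>I. lborel)"
    then have "x \<in> Pi\<^sub>E I A \<longleftrightarrow> (\<forall>i\<in>I. x i \<in> A i)"
      by (auto simp: space_PiM PiE_iff)
    then have "indicator (Pi\<^sub>E I A) x = (\<Prod>i\<in>I. indicator (A i) (x i) :: ennreal)"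
      using I by (auto simp: indicator_def prod_eq_1_iff)
    then show "(\<Prod>i\<in>I. g i (x i)) * indicator (Pi\<^sub>E I A) x = (\<Prod>i\<in>I. g i (x i) * indicator (A i) (x i))"
      by (simp add: prod.distrib)
  qed
  also have "\<dots> = (\<Prod>i\<in>I. \<integral>\<^sup>+y. g i y * indicator (A i) y \<partial>lborel)"
    using A g by (intro L.product_nn_integral_prod I borel_measurable_times_ennreal) auto
  also have "\<dots> = (\<Prod>i\<in>I. emeasure (density lborel (g i)) (A i))"
    using A g by (intro prod.cong refl emeasure_density[symmetric]) auto
  finally show "emeasure (density (\<Pi>\<^sub>M i\<in>I. lborel) (\<lambda>x. \<Prod>i\<in>I. g i (x i))) (Pi\<^sub>E I A)
     = (\<Prod>i\<in>I. emeasure (density lborel (g i)) (A i))" .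
qed

lemma measurable_shifted: "shifted d x \<in> measurable (Rd d) (Rd d)"
  unfolding shifted_def
  by (intro measurable_Rd_I borel_measurable_add borel_measurable_const measurable_Rd_component[where g = "\<lambda>z. z"]) auto

lemma distr_Rd_shifted: "distr (Rd d) (Rd d) (shifted d x) = Rd d"
proof -
  interpret L: product_sigma_finite "\<lambda>_. lborel :: real measure" ..
  have "distr (Rd d) (Rd d) (shifted d x) = (\<Pi>\<^sub>M i\<in>{..<d}. lborel)"
  proof (rule L.PiM_eqI)
    fix A :: "nat \<Rightarrow> real set" assume A: "\<And>i. i \<in> {..<d} \<Longrightarrow> A i \<in> sets lborel"
    have B: "(\<lambda>y. x i + y) -` A i \<in> sets borel" if "i < d" for i
      using measurable_sets[of "\<lambda>y. x i + y" borel borel "A i"] A[of i] that by simp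
    have "emeasure (distr (Rd d) (Rd d) (shifted d x)) (Pi\<^sub>E {..<d} A)
        = emeasure (Rd d) (shifted d x -` Pi\<^sub>E {..<d} A \<inter> space (Rd d))"
      using A by (intro emeasure_distr measurable_shifted) (auto simp: Rd_def intro!: sets_PiM_I_finite)
    also have "shifted d x -` Pi\<^sub>E {..<d} A \<inter> space (Rd d) = Pi\<^sub>E {..<d} (\<lambda>i. (\<lambda>y. x i + y) -` A i)"
      by (auto simp: shifted_def space_Rd PiE_iff)
    also have "emeasure (Rd d) \<dots> = (\<Prod>i<d. emeasure lborel ((\<lambda>y. x i + y) -` A i))"
      unfolding Rd_def using B by (intro L.emeasure_PiM) auto
    also have "\<dots> = (\<Prod>i<d. emeasure lborel (A i))"
    proof (intro prod.cong refl)
      fix i assume "i \<in> {..<d}"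
      then have "emeasure (distr lborel borel (\<lambda>y. x i + y)) (A i) = emeasure lborel ((\<lambda>y. x i + y) -` A i)"
        using A[of i] by (subst emeasure_distr) auto
      then show "emeasure lborel ((\<lambda>y. x i + y) -` A i) = emeasure lborel (A i)"
        using lborel_distr_plus[of "x i"] by simp
    qed
    finally show "emeasure (distr (Rd d) (Rd d) (shifted d x)) (Pi\<^sub>E {..<d} A) = (\<Prod>i<d. emeasure lborel (A i))" .
  qed (auto simp: Rd_def)
  then show ?thesis by (simp add: Rd_def)
qed

text \<open>At a positive time the position has a Gaussian density, so it avoids any given Lebesgue
  null set almost surely. This lets an essential bound on \<open>f\<close> act on
  \<open>f (\<omega> t)\<close> even though the motion starts from a single point.\<close>

lemma AE_wiener_eval:
  assumes W: "wiener_measure d x P" and d: "0 < d" and t: "0 < t" and AE: "AE y in Rd d. \<Phi> y"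
  shows "AE \<omega> in P. \<Phi> (\<omega> t)"
proof -
  interpret prob_space P using wiener_measureD(1)[OF W] .
  note [measurable_cong] = wiener_measureD(2)[OF W]
  have coord: "(\<lambda>\<omega>. \<omega> s i) \<in> borel_measurable P" if "0 \<le> s" "i < d" for s i
    using measurable_path_coordinate[OF that] by simp
  define N where "N = (\<lambda>_::nat. density lborel (\<lambda>y. ennreal (normal_density 0 (sqrt t) y)))"
  have N: "prob_space (N i)" for i
    unfolding N_def using t by (intro prob_space_normal_density) simp
  \<comment> \<open>A grid with the single step from 0 to \<open>t\<close>; the pairs
    \<open>(0, i)\<close> are then reindexed to coordinates.\<close>
  define \<tau> where "\<tau> k = (if k = 0 then 0 else t)" for k :: nat
  let ?I = "{..<1::nat} \<times> {..<d}"
  let ?D = "\<lambda>\<omega>. \<lambda>i\<in>{..<d}. \<omega> t i - \<omega> 0 i :: real"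
  have D: "?D \<in> measurable P (Rd d)"
    using t by (intro measurable_Rd_I borel_measurable_diff coord) auto
  have D2: "(\<lambda>\<omega>. \<lambda>(k, i)\<in>?I. \<omega> (\<tau> (Suc k)) i - \<omega> (\<tau> k) i) \<in> measurable P (\<Pi>\<^sub>M ki\<in>?I. borel)"
    using t by (intro measurable_restrict)
      (auto simp: \<tau>_def intro!: borel_measurable_diff coord)
  have pr: "(\<lambda>\<delta>. \<lambda>i\<in>{..<d}. \<delta> (0::nat, i)) \<in> measurable (\<Pi>\<^sub>M ki\<in>?I. borel) (Rd d)"
    by (intro measurable_Rd_I measurable_component_singleton) auto
  have "distr P (Rd d) ?D = distr (distr P (\<Pi>\<^sub>M ki\<in>?I. borel) (\<lambda>\<omega>. \<lambda>(k, i)\<in>?I. \<omega> (\<tau> (Suc k)) i - \<omega> (\<tau> k) i))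
      (Rd d) (\<lambda>\<delta>. \<lambda>i\<in>{..<d}. \<delta> (0::nat, i))"
    by (subst distr_distr[OF pr D2]) (auto intro!: distr_cong simp: \<tau>_def)
  also have "\<dots> = distr (\<Pi>\<^sub>M ki\<in>?I. N (snd ki)) (Rd d) (\<lambda>\<delta>. \<lambda>i\<in>{..<d}. \<delta> (0::nat, i))"
  proof -
    have "(\<Pi>\<^sub>M ki\<in>?I. density lborel
        (\<lambda>y. ennreal (normal_density 0 (sqrt (\<tau> (Suc (fst ki)) - \<tau> (fst ki))) y))) = (\<Pi>\<^sub>M ki\<in>?I. N (snd ki))"
      by (intro PiM_cong refl) (auto simp: \<tau>_def N_def)
    moreover have "\<tau> 0 = 0" "\<And>k. k < 1 \<Longrightarrow> \<tau> k < \<tau> (Suc k)"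
      using t by (auto simp: \<tau>_def)
    ultimately show ?thesis
      using wiener_increments_distr[OF W, of \<tau> 1] d by simp
  qed
  also have "\<dots> = distr (\<Pi>\<^sub>M ki\<in>?I. N (snd ki)) (\<Pi>\<^sub>M i\<in>{..<d}. N (snd (0::nat, i))) (\<lambda>\<delta>. \<lambda>i\<in>{..<d}. \<delta> (0::nat, i))"
    by (intro distr_cong) (auto simp: Rd_def N_def cong: sets_PiM_cong)
  also have "\<dots> = (\<Pi>\<^sub>M i\<in>{..<d}. N (snd (0::nat, i)))"
    by (rule distr_PiM_reindex) (auto simp: N inj_on_def)
  also have "\<dots> = density (Rd d) (\<lambda>x. \<Prod>i<d. ennreal (normal_density 0 (sqrt t) (x i)))"
    using N unfolding Rd_def N_def by (simp add: PiM_density)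
  finally have law: "distr P (Rd d) ?D = density (Rd d) (\<lambda>x. \<Prod>i<d. ennreal (normal_density 0 (sqrt t) (x i)))" .
  \<comment> \<open>By translation invariance of Lebesgue measure the exceptional set may be moved
    by the start before the centred density is applied.\<close>
  have "AE y in distr (Rd d) (Rd d) (shifted d x). \<Phi> y"
    by (subst distr_Rd_shifted) (rule AE)
  then have "AE \<delta> in Rd d. \<Phi> (shifted d x \<delta>)"
    by (rule AE_distrD[OF measurable_shifted])
  then have "AE \<delta> in distr P (Rd d) ?D. \<Phi> (shifted d x \<delta>)"
  proof -
    have "(\<lambda>x. \<Prod>i<d. ennreal (normal_density 0 (sqrt t) (x i))) \<in> borel_measurable (Rd d)"
      unfolding Rd_def
      by (intro borel_measurable_prod_ennreal measurable_compose[OF measurable_component_singleton]) auto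
    then show ?thesis
      unfolding law using \<open>AE \<delta> in Rd d. \<Phi> (shifted d x \<delta>)\<close>
      by (subst AE_density) (assumption, erule eventually_mono, simp)
  qed
  then have "AE \<omega> in P. \<Phi> (shifted d x (?D \<omega>))"
    by (rule AE_distrD[OF D])
  then show ?thesis
    using wiener_measureD(4)[OF W] AE_space
  proof eventually_elim
    case (elim \<omega>)
    have "\<omega> t \<in> space (Rd d)"
      using elim(3) t path_space_in_Rd[of \<omega> d t] wiener_measureD(3)[OF W] by simp
    then have "shifted d x (?D \<omega>) = \<omega> t"
      using elim(2) by (auto simp: shifted_def space_Rd fun_eq_iff PiE_iff extensional_def)
    then show ?case using elim(1) by simp
  qed
qed

section \<open>Measurability of the Feynman-Kac functional\<close>

lemma measurable_path_integral:
  fixes V :: "(nat \<Rightarrow> real) \<Rightarrow> real"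
  assumes V: "V \<in> borel_measurable (Rd d)"
    and [measurable]: "t \<in> borel_measurable N" "y \<in> measurable N (Rd d)" "w \<in> measurable N (path_space d)"
  shows "(\<lambda>z. LINT s:{0..t z}|lborel. V (shifted d (y z) (w z (max 0 s)))) \<in> borel_measurable N"
proof -
  note [measurable (raw)] = measurable_compose[OF _ V]
  show ?thesis
    \<comment> \<open>As an indicator the moving domain becomes part of the integrand, and
      measurability in the parameter reduces to joint measurability.\<close>
    unfolding set_lebesgue_integral_def indicator_def atLeastAtMost_iff by measurable
qed

lemma measurable_feynman_kac:
  fixes f :: "(nat \<Rightarrow> real) \<Rightarrow> complex" and V :: "(nat \<Rightarrow> real) \<Rightarrow> real"
  assumes V: "V \<in> borel_measurable (Rd d)" and f: "f \<in> borel_measurable (Rd d)"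
    and m: "t \<in> borel_measurable N" "y \<in> measurable N (Rd d)" "w \<in> measurable N (path_space d)"
  shows "(\<lambda>z. exp (- (LINT s:{0..t z}|lborel. V (shifted d (y z) (w z (max 0 s)))))
      *\<^sub>R f (shifted d (y z) (w z (max 0 (t z))))) \<in> borel_measurable N"
  by (intro borel_measurable_scaleR measurable_compose[OF _ borel_measurable_exp] borel_measurable_uminus
      measurable_path_integral[OF V m] measurable_compose[OF measurable_shifted_path[OF m(2,3,1)] f])

lemma origin_in_Rd: "(\<lambda>i\<in>{..<d}. 0) \<in> space (Rd d)"
  by (simp add: space_Rd)

lemma shifted_origin:
  assumes "\<omega> \<in> space (path_space d)" "0 \<le> s"
  shows "shifted d (\<lambda>i\<in>{..<d}. 0) (\<omega> s) = \<omega> s"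
  using path_space_in_Rd[OF assms] by (auto simp: shifted_def space_Rd fun_eq_iff PiE_iff extensional_def)

text \<open>Moves the dependence on \<open>x\<close> from the measure into the integrand, under one
  fixed law \<open>Q\<close>. In this form joint measurability in \<open>(x, t)\<close> follows from
  that of the integrand.\<close>

lemma semigroup_L_eq:
  fixes f :: "(nat \<Rightarrow> real) \<Rightarrow> complex" and V :: "(nat \<Rightarrow> real) \<Rightarrow> real"
  assumes V: "V \<in> borel_measurable (Rd d)" and f: "f \<in> borel_measurable (Rd d)"
    and W: "wiener_measure d x (W x)" and Q: "wiener_measure d (\<lambda>i\<in>{..<d}. 0) Q" and d: "0 < d"
    and x: "x \<in> space (Rd d)" and t: "0 \<le> t"
  shows "semigroup_L W V t f x
    = (LINT \<omega>|Q. exp (- (LINT s:{0..t}|lborel. V (shifted d x (\<omega> (max 0 s)))))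
        *\<^sub>R f (shifted d x (\<omega> (max 0 t))))"
proof -
  note [measurable_cong] = wiener_measureD(2)[OF Q]
  \<comment> \<open>Translation by the origin fixes the points of \<open>Rd d\<close>; it puts the
    original integrand into the form covered by \<open>measurable_feynman_kac\<close>.\<close>
  let ?o = "\<lambda>i\<in>{..<d}. 0 :: real"
  let ?F = "\<lambda>y \<omega>. exp (- (LINT s:{0..t}|lborel. V (shifted d y (\<omega> (max 0 s))))) *\<^sub>R f (shifted d y (\<omega> (max 0 t)))"
  have o: "?o \<in> space (Rd d)" by (simp add: space_Rd)
  note oeq = shifted_origin
  have pw: "exp (- (LINT s:{0..t}|lborel. V (\<omega> s))) *\<^sub>R f (\<omega> t) = ?F ?o \<omega>"
    if "\<omega> \<in> space (path_space d)" for \<omega>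
  proof -
    have "(LINT s:{0..t}|lborel. V (\<omega> s)) = (LINT s:{0..t}|lborel. V (shifted d ?o (\<omega> (max 0 s))))"
      by (intro set_lebesgue_integral_cong) (auto simp: oeq[OF that])
    then show ?thesis using oeq[OF that t] t by simp
  qed
  have meas: "?F y \<in> borel_measurable (path_space d)" if "y \<in> space (Rd d)" for y
    using that by (intro measurable_feynman_kac[OF V f]) auto
  have "semigroup_L W V t f x = (LINT \<omega>|W x. ?F ?o \<omega>)"
    unfolding semigroup_L_def
    by (intro Bochner_Integration.integral_cong refl) (simp add: pw wiener_measureD(3)[OF W])
  also have "\<dots> = (LINT \<omega>|distr Q (path_space d) (shifted_path d x). ?F ?o \<omega>)"
    by (subst wiener_measure_shift[OF W Q d x]) simp
  also have "\<dots> = (LINT \<omega>|Q. ?F ?o (shifted_path d x \<omega>))"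
    using measurable_shifted_path_map by (intro integral_distr meas o) simp
  also have "\<dots> = (LINT \<omega>|Q. ?F x \<omega>)"
  proof (intro Bochner_Integration.integral_cong refl)
    fix \<omega>
    have "shifted d ?o (shifted_path d x \<omega> (max 0 s)) = shifted d x (\<omega> (max 0 s))" for s
      by (auto simp: shifted_path_def shifted_def)
    then show "?F ?o (shifted_path d x \<omega>) = ?F x \<omega>" by simp
  qed
  finally show ?thesis .
qed

text \<open>The first claim is what integrability in \<open>t\<close> needs. The second is essential
  because \<open>Linf_norm\<close> is infinite on a function whose modulus is not measurable,
  whatever its pointwise bounds.\<close>

lemma
  fixes f :: "(nat \<Rightarrow> real) \<Rightarrow> complex" and V :: "(nat \<Rightarrow> real) \<Rightarrow> real"
  assumes V: "V \<in> borel_measurable (Rd d)" and f: "f \<in> borel_measurable (Rd d)"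
    and W: "\<And>x. x \<in> space (Rd d) \<Longrightarrow> wiener_measure d x (W x)" and d: "0 < d"
  shows measurable_semigroup_L_time: "x \<in> space (Rd d) \<Longrightarrow>
      set_borel_measurable lborel {0<..} (\<lambda>t. t powr (a - 1) *\<^sub>R semigroup_L W V t f x)"
    and measurable_riesz_transform: "riesz_transform W V a f \<in> borel_measurable (Rd d)"
proof -
  let ?o = "\<lambda>i\<in>{..<d}. 0 :: real"
  \<comment> \<open>The member of the family at the origin serves as the common reference
    law.\<close>
  define Q where "Q = W ?o"
  have Q: "wiener_measure d ?o Q"
    unfolding Q_def by (rule W) (simp add: space_Rd)
  interpret Q: prob_space Q using wiener_measureD(1)[OF Q] .
  note [measurable_cong] = wiener_measureD(2)[OF Q]
  define S where "S = (\<lambda>(x, t). LINT \<omega>|Q. exp (- (LINT s:{0..t}|lborel. V (shifted d x (\<omega> (max 0 s)))))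
        *\<^sub>R f (shifted d x (\<omega> (max 0 t))))"
  have S: "semigroup_L W V t f x = S (x, t)" if "x \<in> space (Rd d)" "0 \<le> t" for x t
    unfolding S_def using semigroup_L_eq[of V d f x W Q t, OF V f W[OF that(1)] Q d that] by simp
  have [measurable]: "S \<in> borel_measurable (Rd d \<Otimes>\<^sub>M lborel)"
  proof -
    have "(\<lambda>(z, \<omega>). exp (- (LINT s:{0..snd z}|lborel. V (shifted d (fst z) (\<omega> (max 0 s)))))
        *\<^sub>R f (shifted d (fst z) (\<omega> (max 0 (snd z))))) \<in> borel_measurable ((Rd d \<Otimes>\<^sub>M lborel) \<Otimes>\<^sub>M Q)"
      unfolding case_prod_beta by (intro measurable_feynman_kac[OF V f]) measurable
    from Q.borel_measurable_lebesgue_integral[OF this]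
    show ?thesis by (simp add: S_def case_prod_beta')
  qed
  show "set_borel_measurable lborel {0<..} (\<lambda>t. t powr (a - 1) *\<^sub>R semigroup_L W V t f x)"
    if "x \<in> space (Rd d)" for x
  proof -
    have [measurable]: "(\<lambda>t. S (x, t)) \<in> borel_measurable lborel"
      using measurable_compose[OF measurable_Pair1'[OF that, of lborel], of S borel] by simp
    have "(\<lambda>t. indicator {0<..} t *\<^sub>R (t powr (a - 1) *\<^sub>R S (x, t))) \<in> borel_measurable lborel"
      by measurable
    also have "(\<lambda>t. indicator {0<..} t *\<^sub>R (t powr (a - 1) *\<^sub>R S (x, t)))
        = (\<lambda>t. indicator {0<..} t *\<^sub>R (t powr (a - 1) *\<^sub>R semigroup_L W V t f x))"
      using S[OF that] by (auto simp: fun_eq_iff indicator_def)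
    finally show ?thesis by (simp add: set_borel_measurable_def)
  qed
  have "(\<lambda>x. (V x powr a / Gamma a) *\<^sub>R (LINT t|lborel. indicator {0<..} t *\<^sub>R (t powr (a - 1) *\<^sub>R S (x, t))))
      \<in> borel_measurable (Rd d)"
    using V by measurable
  then show "riesz_transform W V a f \<in> borel_measurable (Rd d)"
  proof (subst measurable_cong)
    fix x assume x: "x \<in> space (Rd d)"
    have "(LINT t|lborel. indicator {0<..} t *\<^sub>R (t powr (a - 1) *\<^sub>R semigroup_L W V t f x))
        = (LINT t|lborel. indicator {0<..} t *\<^sub>R (t powr (a - 1) *\<^sub>R S (x, t)))"
    proof (intro Bochner_Integration.integral_cong refl)
      fix t :: real
      show "indicator {0<..} t *\<^sub>R (t powr (a - 1) *\<^sub>R semigroup_L W V t f x)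
          = indicator {0<..} t *\<^sub>R (t powr (a - 1) *\<^sub>R S (x, t))"
        using S[OF x, of t] by (cases "0 < t") simp_all
    qed
    then show "riesz_transform W V a f x
       = (V x powr a / Gamma a) *\<^sub>R (LINT t|lborel. indicator {0<..} t *\<^sub>R (t powr (a - 1) *\<^sub>R S (x, t)))"
      unfolding riesz_transform_def set_lebesgue_integral_def by (simp only:)
  qed
qed

section \<open>Decay of the Feynman--Kac weight\<close>

lemma sum_indicator_consecutive:
  fixes h s :: real
  assumes "0 < h"
  shows "(\<Sum>k<n. indicator {0..<h} (s - real k * h) :: real) = indicator {0..<real n * h} s"
proof (induction n)
  case (Suc n)
  define b where "b = real n * h"
  have "0 \<le> b" "real (Suc n) * h = b + h" using assms by (auto simp: b_def algebra_simps)
  then show ?case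
    unfolding sum.lessThan_Suc Suc b_def[symmetric] using assms by (auto simp: indicator_def)
qed simp

text \<open>Jensen's inequality, from the tangent line of \<open>exp\<close> at the mean.\<close>

lemma exp_integral_le_skeleton:
  fixes g :: "real \<Rightarrow> real"
  assumes h: "0 < h" and g [measurable]: "g \<in> borel_measurable borel" and nonneg: "\<And>s. 0 \<le> g s"
    and int: "set_integrable lborel {0..real n * h} g"
  shows "ennreal (h * exp (- (LINT s:{0..real n * h}|lborel. g s)))
    \<le> (\<integral>\<^sup>+r. ennreal (indicator {0..<h} r * exp (- (h * (\<Sum>k<n. g (real k * h + r))))) \<partial>lborel)"
proof -
  define B where "B = (LINT s:{0..real n * h}|lborel. g s)"
  define G where "G r = (\<Sum>k<n. g (real k * h + r))" for r
  have [measurable]: "G \<in> borel_measurable borel" unfolding G_def by measurable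
  have Gnn: "0 \<le> G r" for r by (simp add: G_def sum_nonneg nonneg)
  let ?i = "\<lambda>r. indicator {0..<h} r :: real"
  have int1: "integrable lborel (\<lambda>s. indicator {0..real n * h} s * g s)"
    using int by (simp add: set_integrable_def)
  have intk: "integrable lborel (\<lambda>s. ?i (s - real k * h) * g s)" if "k < n" for k
  proof (rule Bochner_Integration.integrable_bound[OF int1])
    have "real k * h + h \<le> real n * h"
      using that h mult_right_mono[of "real k + 1" "real n" h] by (simp add: algebra_simps)
    moreover have "0 \<le> real k * h" using h by simp
    ultimately show "AE s in lborel. norm (?i (s - real k * h) * g s) \<le> norm (indicator {0..real n * h} s * g s)"
      by (intro always_eventually) (auto simp: indicator_def)
  qed measurable
  have shift: "(LINT s|lborel. ?i (s - real k * h) * g s) = (LINT r|lborel. ?i r * g (real k * h + r))"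
    and shift_int: "integrable lborel (\<lambda>r. ?i r * g (real k * h + r))" if "k < n" for k
    using lborel_integral_real_affine[of 1 "\<lambda>s. ?i (s - real k * h) * g s" "real k * h"]
      lborel_integrable_real_affine[OF intk[OF that], of 1 "real k * h"] by simp_all
  have Gint: "integrable lborel (\<lambda>r. ?i r * G r)"
    unfolding G_def sum_distrib_left using shift_int by (intro Bochner_Integration.integrable_sum) auto
  \<comment> \<open>\<open>A\<close> is the mean of \<open>h * G\<close> over
    \<open>{0..<h}\<close>; as the translated windows tile the interval, it is also the integral of
    \<open>g\<close> up to time \<open>real n * h\<close>.\<close>
  define A where "A = (LINT r|lborel. ?i r * G r)"
  have "A = (\<Sum>k<n. LINT r|lborel. ?i r * g (real k * h + r))"
    unfolding A_def G_def sum_distrib_left using shift_int by (intro Bochner_Integration.integral_sum) auto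
  also have "\<dots> = (LINT s|lborel. (\<Sum>k<n. ?i (s - real k * h) * g s))"
    using intk shift by (subst Bochner_Integration.integral_sum) auto
  also have "\<dots> = (LINT s|lborel. indicator {0..<real n * h} s * g s)"
    by (simp add: sum_distrib_right[symmetric] sum_indicator_consecutive[OF h])
  also have "\<dots> \<le> B"
    unfolding B_def set_lebesgue_integral_def
  proof (rule integral_mono_AE')
    show "integrable lborel (\<lambda>s. indicator {0..real n * h} s *\<^sub>R g s)"
      using int by (simp add: set_integrable_def)
  qed (auto intro!: always_eventually simp: indicator_def nonneg)
  finally have AB: "A \<le> B" .
  let ?E = "\<lambda>r. ?i r * exp (- (h * G r))"
  have ii: "integrable lborel ?i" using h by (simp add: integrable_indicator_iff)
  have Eint: "integrable lborel ?E"
    by (rule Bochner_Integration.integrable_bound[OF ii])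
      (use h Gnn in \<open>auto intro!: always_eventually simp: indicator_def\<close>)
  have "h * exp (- B) \<le> h * exp (- A)"
    using AB h by simp
  \<comment> \<open>The integrand is the tangent of \<open>exp\<close> at \<open>- A\<close>, taken
    at \<open>- (h * G r)\<close>. Since \<open>A\<close> is the mean of \<open>h * G\<close>, the
    linear part integrates to zero.\<close>
  also have "\<dots> = (LINT r|lborel. exp (- A) * (1 + A) * ?i r - exp (- A) * h * (?i r * G r))"
  proof -
    have "(LINT r|lborel. exp (- A) * (1 + A) * ?i r - exp (- A) * h * (?i r * G r))
        = exp (- A) * (1 + A) * (LINT r|lborel. ?i r) - exp (- A) * h * A"
      unfolding A_def using ii Gint
      by (subst Bochner_Integration.integral_diff)
        (simp_all only: Bochner_Integration.integral_mult_right_zero integrable_mult_right)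
    also have "(LINT r|lborel. ?i r) = h" using h by simp
    finally show ?thesis by (simp add: algebra_simps)
  qed
  also have "\<dots> \<le> (LINT r|lborel. ?E r)"
  proof (rule integral_mono)
    show "exp (- A) * (1 + A) * ?i r - exp (- A) * h * (?i r * G r) \<le> ?E r" for r
    proof -
      have "exp (- A) * (1 + (A - h * G r)) \<le> exp (- A) * exp (A - h * G r)"
        by (intro mult_left_mono exp_ge_add_one_self) simp
      also have "\<dots> = exp (- (h * G r))" by (simp add: mult_exp_exp)
      finally show ?thesis by (simp add: indicator_def algebra_simps)
    qed
  qed (use ii Gint Eint in auto)
  finally have "ennreal (h * exp (- B)) \<le> ennreal (LINT r|lborel. ?E r)"
    by (rule ennreal_leI)
  also have "\<dots> = (\<integral>\<^sup>+r. ennreal (?E r) \<partial>lborel)"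
    by (rule nn_integral_eq_integral[symmetric, OF Eint]) simp
  finally show ?thesis by (simp add: B_def G_def)
qed

text \<open>Each sum over coordinates is split in halves, one for either adjacent increment, and two
  such halves dominate an increment by \<open>quarter_powr_le\<close>, whence 8 = 2 * 4. No
  increment precedes the first sum, so half of it remains for the damping at the start.\<close>

lemma skeleton_sum_lower_bound:
  fixes Y :: "nat \<Rightarrow> nat \<Rightarrow> real"
  assumes \<alpha>: "0 < \<alpha>" "\<alpha> \<le> 2" and d: "0 < d"
  shows "(\<Sum>i<d. \<bar>Y 0 i\<bar> powr \<alpha>) / 2 + (\<Sum>k<p. \<bar>Y (Suc k) 0 - Y k 0\<bar> powr \<alpha> / 8)
    \<le> (\<Sum>k<Suc p. \<Sum>i<d. \<bar>Y k i\<bar> powr \<alpha>)"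
proof -
  define S where "S k = (\<Sum>i<d. \<bar>Y k i\<bar> powr \<alpha>)" for k
  define D where "D k = \<bar>Y (Suc k) 0 - Y k 0\<bar> powr \<alpha> / 8" for k
  have step: "D k \<le> (S k + S (Suc k)) / 2" for k
  proof -
    have le: "\<bar>Y j 0\<bar> powr \<alpha> \<le> S j" for j
      unfolding S_def using d by (intro member_le_sum) auto
    show ?thesis
      using quarter_powr_le[OF \<alpha>, of "Y (Suc k) 0" "- Y k 0"] le[of k] le[of "Suc k"]
      by (simp add: D_def)
  qed
  \<comment> \<open>The term \<open>S p / 2\<close> is the half that the next increment will
    consume; it is dropped at the end.\<close>
  have "S 0 / 2 + (\<Sum>k<p. D k) + S p / 2 \<le> (\<Sum>k<Suc p. S k)"
  proof (induction p)
    case (Suc p)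
    then show ?case using step[of p] unfolding sum.lessThan_Suc by (simp add: field_simps)
  qed simp
  moreover have "0 \<le> S p" by (simp add: S_def sum_nonneg)
  ultimately show ?thesis by (simp add: S_def D_def)
qed

lemma prod_mono_ennreal:
  fixes g h :: "'i \<Rightarrow> ennreal"
  assumes "\<And>i. i \<in> I \<Longrightarrow> g i \<le> h i"
  shows "prod g I \<le> prod h I"
  using assms by (induction I rule: infinite_finite_induct) (auto intro: mult_mono)

text \<open>After \<open>skeleton_sum_lower_bound\<close> the exponent is a sum of functions of
  separate increments, so independence turns the expectation into a product. The first step gives
  one damping factor per coordinate, and each of the \<open>p\<close> later steps contributes
  \<open>q\<close> from coordinate 0.\<close>

lemma wiener_skeleton_bound:
  assumes W: "wiener_measure d x P" and d: "0 < d"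
    and \<alpha>: "0 < \<alpha>" "\<alpha> \<le> 2" and m: "0 < m" and r: "0 < r" "r \<le> 1" and h: "0 < h" "h \<le> 1"
    and V: "\<And>y. y \<in> space (Rd d) \<Longrightarrow> m * (\<Sum>i<d. \<bar>y i\<bar> powr \<alpha>) \<le> V y"
    and c: "\<And>z. (\<integral>\<^sup>+y. ennreal (normal_density 0 (sqrt r) y * exp (- (h * (m / 2) * \<bar>z + y\<bar> powr \<alpha>))) \<partial>lborel)
         \<le> ennreal (exp (- (c * (h * \<bar>z\<bar> powr \<alpha>))))"
    and q: "(\<integral>\<^sup>+y. ennreal (normal_density 0 (sqrt h) y * exp (- (h * (m / 8) * \<bar>y\<bar> powr \<alpha>))) \<partial>lborel) \<le> ennreal q"
    and q0: "0 \<le> q"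
  shows "(\<integral>\<^sup>+\<omega>. ennreal (exp (- (h * (\<Sum>k<Suc p. V (\<omega> (real k * h + r)))))) \<partial>P)
     \<le> ennreal (exp (- (c * h * (\<Sum>i<d. \<bar>x i\<bar> powr \<alpha>))) * q ^ p)"
proof -
  interpret prob_space P using wiener_measureD(1)[OF W] .
  note [measurable_cong] = wiener_measureD(2)[OF W]
  \<comment> \<open>The grid is 0, \<open>r\<close>, \<open>r + h\<close>, and so on: one initial
    step of variance \<open>r\<close>, then \<open>p\<close> steps of variance
    \<open>h\<close>.\<close>
  define t where "t k = (if k = 0 then 0 else real (k - 1) * h + r)" for k
  have t0: "t 0 = 0" and tS: "t (Suc k) = real k * h + r" for k by (auto simp: t_def)
  have t_nonneg: "0 \<le> t k" for k using h r by (simp add: t_def)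
  have t_mono: "t k < t (Suc k)" for k
    using h r by (cases k) (auto simp: t_def algebra_simps)
  let ?I = "{..<Suc p} \<times> {..<d}"
  let ?X = "\<lambda>ki \<omega>. \<omega> (t (Suc (fst ki))) (snd ki) - \<omega> (t (fst ki)) (snd ki) :: real"
  \<comment> \<open>The value 0 on later increments of the other coordinates makes their factors
    equal to 1, so their number does not matter.\<close>
  define \<phi> where "\<phi> ki y = (if fst ki = 0 then h * (m / 2) * \<bar>x (snd ki) + y\<bar> powr \<alpha>
      else if snd ki = 0 then h * (m / 8) * \<bar>y\<bar> powr \<alpha> else 0)" for ki :: "nat \<times> nat" and y :: real
  have [measurable]: "\<phi> ki \<in> borel_measurable borel" for ki
    unfolding \<phi>_def by (cases "fst ki = 0"; cases "snd ki = 0") simp_all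
  have ind: "indep_vars (\<lambda>_. borel) ?X ?I"
    using wiener_measureD(6)[OF W, of t "Suc p"] t_mono t0 by (simp add: case_prod_beta')
  have D: "distributed P lborel (?X ki) (\<lambda>y. ennreal (normal_density 0 (sqrt (t (Suc (fst ki)) - t (fst ki))) y))"
    if "ki \<in> ?I" for ki
    using that by (intro wiener_measureD(5)[OF W t_nonneg t_mono]) auto
  have one: "(\<integral>\<^sup>+\<omega>. ennreal (exp (- \<phi> ki (?X ki \<omega>))) \<partial>P)
      \<le> (if fst ki = 0 then ennreal (exp (- (c * (h * \<bar>x (snd ki)\<bar> powr \<alpha>)))) else if snd ki = 0 then ennreal q else 1)"
    if "ki \<in> ?I" for ki
  proof -
    have "(\<integral>\<^sup>+\<omega>. ennreal (exp (- \<phi> ki (?X ki \<omega>))) \<partial>P)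
      = (\<integral>\<^sup>+y. ennreal (normal_density 0 (sqrt (t (Suc (fst ki)) - t (fst ki))) y) * ennreal (exp (- \<phi> ki y)) \<partial>lborel)"
      by (rule distributed_nn_integral[OF D[OF that], symmetric]) simp
    also have "\<dots> = (\<integral>\<^sup>+y. ennreal (normal_density 0 (sqrt (t (Suc (fst ki)) - t (fst ki))) y * exp (- \<phi> ki y)) \<partial>lborel)"
      by (simp add: ennreal_mult)
    also have "\<dots> \<le> (if fst ki = 0 then ennreal (exp (- (c * (h * \<bar>x (snd ki)\<bar> powr \<alpha>)))) else if snd ki = 0 then ennreal q else 1)"
    proof (cases "fst ki")
      case 0
      then show ?thesis using c[of "x (snd ki)"] by (simp add: \<phi>_def t_def)
    next
      case (Suc k)
      have "t (Suc (Suc k)) - t (Suc k) = h" by (simp add: tS algebra_simps)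
      then show ?thesis using Suc q h by (auto simp: \<phi>_def nn_integral_normal_density)
    qed
    finally show ?thesis .
  qed
  have "(\<integral>\<^sup>+\<omega>. ennreal (exp (- (h * (\<Sum>k<Suc p. V (\<omega> (real k * h + r)))))) \<partial>P)
      \<le> (\<integral>\<^sup>+\<omega>. (\<Prod>ki\<in>?I. ennreal (exp (- \<phi> ki (?X ki \<omega>)))) \<partial>P)"
  proof (intro nn_integral_mono_AE)
    show "AE \<omega> in P. ennreal (exp (- (h * (\<Sum>k<Suc p. V (\<omega> (real k * h + r))))))
        \<le> (\<Prod>ki\<in>?I. ennreal (exp (- \<phi> ki (?X ki \<omega>))))"
      using wiener_measureD(4)[OF W] AE_space
    proof eventually_elim
      case (elim \<omega>)
      define Y where "Y k = \<omega> (t (Suc k))" for k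
      have Y: "Y k \<in> space (Rd d)" for k
        unfolding Y_def using elim(2) t_nonneg path_space_in_Rd wiener_measureD(3)[OF W] by simp
      have "(\<Sum>ki\<in>?I. \<phi> ki (?X ki \<omega>)) = (\<Sum>k<Suc p. \<Sum>i<d. \<phi> (k, i) (?X (k, i) \<omega>))"
        unfolding sum.cartesian_product by (intro sum.cong) auto
      also have "\<dots> = (\<Sum>i<d. \<phi> (0, i) (?X (0, i) \<omega>)) + (\<Sum>k<p. \<Sum>i<d. \<phi> (Suc k, i) (?X (Suc k, i) \<omega>))"
        by (rule sum.lessThan_Suc_shift)
      also have "(\<Sum>i<d. \<phi> (0, i) (?X (0, i) \<omega>)) = h * m * ((\<Sum>i<d. \<bar>Y 0 i\<bar> powr \<alpha>) / 2)"
        using elim(1) by (simp add: \<phi>_def Y_def t0 sum_distrib_left sum_divide_distrib algebra_simps)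
      also have "(\<Sum>k<p. \<Sum>i<d. \<phi> (Suc k, i) (?X (Suc k, i) \<omega>)) = h * m * (\<Sum>k<p. \<bar>Y (Suc k) 0 - Y k 0\<bar> powr \<alpha> / 8)"
      proof -
        have "(\<Sum>i<d. \<phi> (Suc k, i) (?X (Suc k, i) \<omega>)) = h * m * (\<bar>Y (Suc k) 0 - Y k 0\<bar> powr \<alpha> / 8)" for k
        proof -
          have "(\<Sum>i<d. \<phi> (Suc k, i) (?X (Suc k, i) \<omega>)) = (\<Sum>i\<in>{0}. \<phi> (Suc k, i) (?X (Suc k, i) \<omega>))"
            using d by (intro sum.mono_neutral_right) (auto simp: \<phi>_def)
          then show ?thesis by (simp add: \<phi>_def Y_def)
        qed
        then show ?thesis by (simp only: sum_distrib_left)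
      qed
      also have "h * m * ((\<Sum>i<d. \<bar>Y 0 i\<bar> powr \<alpha>) / 2) + h * m * (\<Sum>k<p. \<bar>Y (Suc k) 0 - Y k 0\<bar> powr \<alpha> / 8)
          \<le> h * (\<Sum>k<Suc p. V (Y k))"
      proof -
        have "m * ((\<Sum>i<d. \<bar>Y 0 i\<bar> powr \<alpha>) / 2 + (\<Sum>k<p. \<bar>Y (Suc k) 0 - Y k 0\<bar> powr \<alpha> / 8))
            \<le> m * (\<Sum>k<Suc p. \<Sum>i<d. \<bar>Y k i\<bar> powr \<alpha>)"
          using m by (intro mult_left_mono skeleton_sum_lower_bound \<alpha> d) simp
        also have "\<dots> = (\<Sum>k<Suc p. m * (\<Sum>i<d. \<bar>Y k i\<bar> powr \<alpha>))"
          by (rule sum_distrib_left)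
        also have "\<dots> \<le> (\<Sum>k<Suc p. V (Y k))"
          by (intro sum_mono V Y)
        finally have "h * (m * ((\<Sum>i<d. \<bar>Y 0 i\<bar> powr \<alpha>) / 2 + (\<Sum>k<p. \<bar>Y (Suc k) 0 - Y k 0\<bar> powr \<alpha> / 8)))
            \<le> h * (\<Sum>k<Suc p. V (Y k))"
          using h by (intro mult_left_mono) auto
        then show ?thesis by (simp add: algebra_simps)
      qed
      finally have "exp (- (h * (\<Sum>k<Suc p. V (Y k)))) \<le> exp (\<Sum>ki\<in>?I. - \<phi> ki (?X ki \<omega>))"
        by (simp add: sum_negf)
      also have "\<dots> = (\<Prod>ki\<in>?I. exp (- \<phi> ki (?X ki \<omega>)))"
        by (rule exp_sum) simp
      finally have "ennreal (exp (- (h * (\<Sum>k<Suc p. V (Y k))))) \<le> ennreal (\<Prod>ki\<in>?I. exp (- \<phi> ki (?X ki \<omega>)))"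
        by (rule ennreal_leI)
      then show ?case by (simp only: Y_def tS prod_ennreal exp_ge_zero)
    qed
  qed
  also have "\<dots> = (\<Prod>ki\<in>?I. \<integral>\<^sup>+\<omega>. ennreal (exp (- \<phi> ki (?X ki \<omega>))) \<partial>P)"
    using indep_vars_compose2[OF ind, of "\<lambda>ki y. ennreal (exp (- \<phi> ki y))" "\<lambda>_. borel"]
    by (intro indep_vars_nn_integral) auto
  also have "\<dots> \<le> (\<Prod>ki\<in>?I. if fst ki = 0 then ennreal (exp (- (c * (h * \<bar>x (snd ki)\<bar> powr \<alpha>))))
      else if snd ki = 0 then ennreal q else 1)"
    using one by (rule prod_mono_ennreal)
  also have "\<dots> = (\<Prod>k<Suc p. \<Prod>i<d. if k = 0 then ennreal (exp (- (c * (h * \<bar>x i\<bar> powr \<alpha>))))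
      else if i = 0 then ennreal q else 1)"
    by (simp add: prod.cartesian_product case_prod_beta')
  also have "\<dots> = (\<Prod>i<d. ennreal (exp (- (c * (h * \<bar>x i\<bar> powr \<alpha>))))) * (\<Prod>k<p. \<Prod>i<d. if i = 0 then ennreal q else 1)"
    by (subst prod.lessThan_Suc_shift) simp
  also have "(\<Prod>i<d. ennreal (exp (- (c * (h * \<bar>x i\<bar> powr \<alpha>))))) = ennreal (exp (- (c * h * (\<Sum>i<d. \<bar>x i\<bar> powr \<alpha>))))"
    by (simp add: prod_ennreal exp_sum[symmetric] sum_distrib_left sum_negf mult_ac)
  also have "(\<Prod>i<d. if i = 0 then ennreal q else 1) = ennreal q"
    using d by (simp add: prod.delta)
  also have "ennreal (exp (- (c * h * (\<Sum>i<d. \<bar>x i\<bar> powr \<alpha>)))) * (\<Prod>k<p. ennreal q)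
      = ennreal (exp (- (c * h * (\<Sum>i<d. \<bar>x i\<bar> powr \<alpha>))) * q ^ p)"
    using q0 by (simp add: ennreal_mult ennreal_power)
  finally show ?thesis .
qed

section \<open>From the skeleton to the path integral\<close>

text \<open>The Bochner integral of a non-integrable function is 0, and the weight would then be 1,
  so integrability along every path is essential. \<open>V\<close> is merely measurable, hence the
  domination by a continuous function of time, with squares in place of powers \<alpha>.\<close>

lemma path_set_integrable:
  assumes \<omega>: "\<omega> \<in> space (path_space d)" and V: "V \<in> borel_measurable (Rd d)"
    and \<alpha>: "0 < \<alpha>" "\<alpha> \<le> 2" and M: "0 \<le> M" and T: "0 \<le> T"
    and nonneg: "\<And>y. y \<in> space (Rd d) \<Longrightarrow> 0 \<le> V y"
    and upper: "\<And>y. y \<in> space (Rd d) \<Longrightarrow> V y \<le> M * (\<Sum>i<d. \<bar>y i\<bar> powr \<alpha>)"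
  shows "set_integrable lborel {0..T} (\<lambda>s. V (shifted d (\<lambda>i\<in>{..<d}. 0) (\<omega> (max 0 s))))"
proof (rule set_integrable_bound)
  define b where "b s = M * (\<Sum>i<d. 1 + (\<omega> s i)\<^sup>2)" for s
  have "continuous_on {0..T} b"
    unfolding b_def
    by (intro continuous_intros continuous_on_subset[OF path_space_continuous[OF \<omega>]]) auto
  then show "set_integrable lborel {0..T} b"
    unfolding set_integrable_def by (intro borel_integrable_compact) auto
  have [measurable]: "(\<lambda>s. shifted d (\<lambda>i\<in>{..<d}. 0) (\<omega> (max 0 s))) \<in> measurable lborel (Rd d)"
    by (rule measurable_shifted_path)
      (rule measurable_const[OF origin_in_Rd], rule measurable_const[OF \<omega>], measurable)
  show "set_borel_measurable lborel {0..T} (\<lambda>s. V (shifted d (\<lambda>i\<in>{..<d}. 0) (\<omega> (max 0 s))))"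
    unfolding set_borel_measurable_def using V by measurable
  show "AE s in lborel. s \<in> {0..T} \<longrightarrow> norm (V (shifted d (\<lambda>i\<in>{..<d}. 0) (\<omega> (max 0 s)))) \<le> norm (b s)"
  proof (intro always_eventually allI impI)
    fix s assume s: "s \<in> {0..T}"
    then have \<omega>s: "\<omega> s \<in> space (Rd d)" using path_space_in_Rd[OF \<omega>] by simp
    have "V (\<omega> s) \<le> M * (\<Sum>i<d. \<bar>\<omega> s i\<bar> powr \<alpha>)" using upper[OF \<omega>s] .
    also have "\<dots> \<le> b s"
      unfolding b_def using M by (intro mult_left_mono sum_mono powr_exponent_le_one_plus_square \<alpha>)
    finally show "norm (V (shifted d (\<lambda>i\<in>{..<d}. 0) (\<omega> (max 0 s)))) \<le> norm (b s)"
      using nonneg[OF \<omega>s] s shifted_origin[OF \<omega>, of s] by (simp add: max_def)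
  qed
qed

lemma measurable_wiener_path_integral:
  fixes V :: "(nat \<Rightarrow> real) \<Rightarrow> real"
  assumes W: "wiener_measure d x P" and V: "V \<in> borel_measurable (Rd d)"
  shows "(\<lambda>\<omega>. LINT s:{0..t}|lborel. V (\<omega> s)) \<in> borel_measurable P"
proof (subst measurable_cong)
  show "(\<lambda>\<omega>. LINT s:{0..t}|lborel. V (shifted d (\<lambda>i\<in>{..<d}. 0) (\<omega> (max 0 s)))) \<in> borel_measurable P"
    by (rule measurable_path_integral[OF V])
      (rule borel_measurable_const, rule measurable_const[OF origin_in_Rd],
        rule measurable_ident_sets[OF wiener_measureD(2)[OF W]])
  show "(LINT s:{0..t}|lborel. V (\<omega> s)) = (LINT s:{0..t}|lborel. V (shifted d (\<lambda>i\<in>{..<d}. 0) (\<omega> (max 0 s))))"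
    if "\<omega> \<in> space P" for \<omega>
    using that wiener_measureD(3)[OF W]
    by (intro set_lebesgue_integral_cong) (auto simp: shifted_origin)
qed

text \<open>The skeleton bound is uniform in the offset \<open>r\<close>, so averaging over
  \<open>r\<close> by Fubini and cancelling the window length \<open>h\<close> transfers it to the
  path integral. Times beyond \<open>real (Suc p) * h\<close> are discarded since \<open>V\<close>
  is non-negative.\<close>

lemma wiener_exp_integral_bound:
  assumes W: "wiener_measure d x P" and d: "0 < d" and Vm: "V \<in> borel_measurable (Rd d)"
    and \<alpha>: "0 < \<alpha>" "\<alpha> \<le> 2" and m: "0 < m" and M: "0 \<le> M" and h: "0 < h" "h \<le> 1"
    and lower: "\<And>y. y \<in> space (Rd d) \<Longrightarrow> m * (\<Sum>i<d. \<bar>y i\<bar> powr \<alpha>) \<le> V y"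
    and upper: "\<And>y. y \<in> space (Rd d) \<Longrightarrow> V y \<le> M * (\<Sum>i<d. \<bar>y i\<bar> powr \<alpha>)"
    and c: "\<And>r z. 0 < r \<Longrightarrow> r \<le> 1 \<Longrightarrow>
        (\<integral>\<^sup>+y. ennreal (normal_density 0 (sqrt r) y * exp (- (h * (m / 2) * \<bar>z + y\<bar> powr \<alpha>))) \<partial>lborel)
         \<le> ennreal (exp (- (c * (h * \<bar>z\<bar> powr \<alpha>))))"
    and q: "(\<integral>\<^sup>+y. ennreal (normal_density 0 (sqrt h) y * exp (- (h * (m / 8) * \<bar>y\<bar> powr \<alpha>))) \<partial>lborel) \<le> ennreal q"
    and q0: "0 \<le> q" and t: "real (Suc p) * h \<le> t"
  shows "(\<integral>\<^sup>+\<omega>. ennreal (exp (- (LINT s:{0..t}|lborel. V (\<omega> s)))) \<partial>P)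
     \<le> ennreal (exp (- (c * h * (\<Sum>i<d. \<bar>x i\<bar> powr \<alpha>))) * q ^ p)" (is "?L \<le> ennreal ?C")
proof -
  interpret prob_space P using wiener_measureD(1)[OF W] .
  interpret PL: pair_sigma_finite P "lborel :: real measure" ..
  note [measurable_cong] = wiener_measureD(2)[OF W]
  note sP = wiener_measureD(3)[OF W]
  have nonneg: "0 \<le> V y" if "y \<in> space (Rd d)" for y
    using lower[OF that] m sum_nonneg[of "{..<d}" "\<lambda>i. \<bar>y i\<bar> powr \<alpha>"]
    by (meson mult_nonneg_nonneg order_trans less_imp_le powr_ge_zero)
  let ?o = "\<lambda>i\<in>{..<d}. 0 :: real"
  let ?U = "\<lambda>\<omega> s. V (shifted d ?o (\<omega> (max 0 s)))"
  let ?T = "real (Suc p) * h"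
  have T: "0 \<le> ?T" "0 \<le> t" using h t by (auto intro: order_trans[rotated])
  have Um: "(\<lambda>z. V (shifted d ?o (fst z (max 0 (real k * h + snd z))))) \<in> borel_measurable (P \<Otimes>\<^sub>M lborel)" for k
    by (rule measurable_compose[OF measurable_shifted_path Vm]) (rule measurable_const[OF origin_in_Rd], measurable)
  have Fm: "(\<lambda>(\<omega>, r). ennreal (indicator {0..<h} r * exp (- (h * (\<Sum>k<Suc p. ?U \<omega> (real k * h + r))))))
      \<in> borel_measurable (P \<Otimes>\<^sub>M lborel)"
    unfolding case_prod_beta using Um by measurable
  have pw: "ennreal (h * exp (- (LINT s:{0..t}|lborel. V (\<omega> s))))
      \<le> (\<integral>\<^sup>+r. ennreal (indicator {0..<h} r * exp (- (h * (\<Sum>k<Suc p. ?U \<omega> (real k * h + r))))) \<partial>lborel)"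
    if "\<omega> \<in> space P" for \<omega>
  proof -
    have \<omega>: "\<omega> \<in> space (path_space d)" using that sP by simp
    have "(LINT s:{0..?T}|lborel. ?U \<omega> s) \<le> (LINT s:{0..t}|lborel. ?U \<omega> s)"
      using path_set_integrable[OF \<omega> Vm \<alpha> M T(1) nonneg upper] path_set_integrable[OF \<omega> Vm \<alpha> M T(2) nonneg upper] t
      unfolding set_lebesgue_integral_def set_integrable_def
      by (intro integral_mono) (auto simp: indicator_def intro!: nonneg shifted_in_Rd)
    also have "(LINT s:{0..t}|lborel. ?U \<omega> s) = (LINT s:{0..t}|lborel. V (\<omega> s))"
      by (intro set_lebesgue_integral_cong) (auto simp: shifted_origin[OF \<omega>])
    finally have "ennreal (h * exp (- (LINT s:{0..t}|lborel. V (\<omega> s)))) \<le> ennreal (h * exp (- (LINT s:{0..?T}|lborel. ?U \<omega> s)))"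
      using h by (intro ennreal_leI) simp
    also have "\<dots> \<le> (\<integral>\<^sup>+r. ennreal (indicator {0..<h} r * exp (- (h * (\<Sum>k<Suc p. ?U \<omega> (real k * h + r))))) \<partial>lborel)"
    proof (rule exp_integral_le_skeleton[OF h(1)])
      show "?U \<omega> \<in> borel_measurable borel"
        by (rule measurable_compose[OF measurable_shifted_path Vm]) (rule measurable_const[OF origin_in_Rd], rule measurable_const[OF \<omega>], measurable)
      show "0 \<le> ?U \<omega> s" for s by (intro nonneg shifted_in_Rd)
      show "set_integrable lborel {0..?T} (?U \<omega>)"
        by (rule path_set_integrable[OF \<omega> Vm \<alpha> M T(1) nonneg upper])
    qed
    finally show ?thesis .
  qed
  have Em: "(\<lambda>\<omega>. ennreal (exp (- (LINT s:{0..t}|lborel. V (\<omega> s))))) \<in> borel_measurable P"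
    using measurable_wiener_path_integral[OF W Vm, of t] by measurable
  \<comment> \<open>At offset 0 the first increment degenerates; this single value is null for the
    integral over \<open>r\<close>.\<close>
  have inner: "(\<integral>\<^sup>+\<omega>. ennreal (indicator {0..<h} r * exp (- (h * (\<Sum>k<Suc p. ?U \<omega> (real k * h + r))))) \<partial>P)
      \<le> ennreal ?C * indicator {0..<h} r" if "r \<noteq> 0" for r
  proof (cases "r \<in> {0..<h}")
    case True
    then have r: "0 < r" "r \<le> 1" using that h by auto
    have "(\<integral>\<^sup>+\<omega>. ennreal (indicator {0..<h} r * exp (- (h * (\<Sum>k<Suc p. ?U \<omega> (real k * h + r))))) \<partial>P)
        = (\<integral>\<^sup>+\<omega>. ennreal (exp (- (h * (\<Sum>k<Suc p. V (\<omega> (real k * h + r)))))) \<partial>P)"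
    proof (intro nn_integral_cong)
      fix \<omega> assume "\<omega> \<in> space P"
      then have "?U \<omega> (real k * h + r) = V (\<omega> (real k * h + r))" for k
        using r h sP shifted_origin[of \<omega> d "real k * h + r"] by simp
      then show "ennreal (indicator {0..<h} r * exp (- (h * (\<Sum>k<Suc p. ?U \<omega> (real k * h + r)))))
        = ennreal (exp (- (h * (\<Sum>k<Suc p. V (\<omega> (real k * h + r))))))"
        using True by simp
    qed
    also have "\<dots> \<le> ennreal ?C"
      by (rule wiener_skeleton_bound[OF W d \<alpha> m r h lower c[OF r] q q0])
    finally show ?thesis using True by simp
  qed simp
  have "ennreal h * ?L = (\<integral>\<^sup>+\<omega>. ennreal (h * exp (- (LINT s:{0..t}|lborel. V (\<omega> s)))) \<partial>P)"
    using h Em by (subst nn_integral_cmult[symmetric]) (auto simp: ennreal_mult)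
  also have "\<dots> \<le> (\<integral>\<^sup>+\<omega>. \<integral>\<^sup>+r. ennreal (indicator {0..<h} r * exp (- (h * (\<Sum>k<Suc p. ?U \<omega> (real k * h + r))))) \<partial>lborel \<partial>P)"
    by (intro nn_integral_mono pw)
  also have "\<dots> = (\<integral>\<^sup>+r. \<integral>\<^sup>+\<omega>. ennreal (indicator {0..<h} r * exp (- (h * (\<Sum>k<Suc p. ?U \<omega> (real k * h + r))))) \<partial>P \<partial>lborel)"
    by (rule PL.Fubini'[OF Fm, symmetric])
  also have "\<dots> \<le> (\<integral>\<^sup>+r. ennreal ?C * indicator {0..<h} r \<partial>lborel)"
    using AE_lborel_singleton[of "0::real"]
    by (intro nn_integral_mono_AE) (erule eventually_mono, rule inner)
  also have "\<dots> = ennreal h * ennreal ?C"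
    using h by (subst nn_integral_cmult_indicator) (simp_all add: mult.commute)
  finally show ?thesis
    using h by (subst (asm) ennreal_mult_le_mult_iff) auto
qed

section \<open>Decay in time\<close>

lemma nn_integral_powr_exp:
  fixes a b :: real
  assumes a: "0 < a" and b: "0 < b"
  shows "(\<integral>\<^sup>+t. ennreal (indicator {0<..} t * (t powr (a - 1) * exp (- (b * t)))) \<partial>lborel) = ennreal (Gamma a / b powr a)"
    (is "?I = _")
proof -
  let ?f = "\<lambda>t. ennreal (indicator {0..} t * t powr (a - 1) / exp t)"
  have "?f (b * t) = ennreal (b powr (a - 1)) * ennreal (indicator {0<..} t * (t powr (a - 1) * exp (- (b * t))))" for t
    using b by (cases "0 < t"; cases "t = 0")
      (auto simp: indicator_def powr_mult exp_minus divide_inverse ennreal_mult[symmetric] zero_le_mult_iff)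
  then have "ennreal (Gamma a) = ennreal b * (\<integral>\<^sup>+t. ennreal (b powr (a - 1)) * ennreal (indicator {0<..} t * (t powr (a - 1) * exp (- (b * t)))) \<partial>lborel)"
    using nn_integral_real_affine[of ?f b 0] b by (simp add: Gamma_conv_nn_integral_real[OF a])
  also have "\<dots> = ennreal (b powr a) * ?I"
    using b by (subst nn_integral_cmult) (auto simp: mult.assoc[symmetric] ennreal_mult[symmetric] powr_diff)
  finally have "ennreal (1 / b powr a) * (ennreal (b powr a) * ?I) = ennreal (1 / b powr a) * ennreal (Gamma a)"
    by simp
  then show ?thesis
    using b a by (simp add: mult.assoc[symmetric] ennreal_mult[symmetric] less_imp_le[OF Gamma_real_pos])
qed

text \<open>The factor \<open>exp (2 * \<delta>)\<close> compensates two losses: for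
  \<open>t \<le> 1\<close> no decay at rate \<delta> is extracted, and for larger \<open>t\<close>
  the number of increments used falls short of \<open>t\<close> by at most 2.\<close>

lemma wiener_exp_integral_decay:
  assumes W: "wiener_measure d x P" and d: "0 < d" and Vm: "V \<in> borel_measurable (Rd d)"
    and \<alpha>: "0 < \<alpha>" "\<alpha> \<le> 2" and m: "0 < m" and M: "0 \<le> M"
    and lower: "\<And>y. y \<in> space (Rd d) \<Longrightarrow> m * (\<Sum>i<d. \<bar>y i\<bar> powr \<alpha>) \<le> V y"
    and upper: "\<And>y. y \<in> space (Rd d) \<Longrightarrow> V y \<le> M * (\<Sum>i<d. \<bar>y i\<bar> powr \<alpha>)"
    and c: "\<And>s h z. 0 < s \<Longrightarrow> s \<le> 1 \<Longrightarrow> 0 < h \<Longrightarrow> h \<le> 1 \<Longrightarrow>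
        (\<integral>\<^sup>+y. ennreal (normal_density 0 (sqrt s) y * exp (- (h * (m / 2) * \<bar>z + y\<bar> powr \<alpha>))) \<partial>lborel)
         \<le> ennreal (exp (- (c * (h * \<bar>z\<bar> powr \<alpha>))))"
    and \<delta>: "0 < \<delta>"
      "(\<integral>\<^sup>+y. ennreal (normal_density 0 1 y * exp (- (m / 8 * \<bar>y\<bar> powr \<alpha>))) \<partial>lborel) \<le> ennreal (exp (- \<delta>))"
    and S: "S = (\<Sum>i<d. \<bar>x i\<bar> powr \<alpha>)" and t: "0 < t"
  shows "(\<integral>\<^sup>+\<omega>. ennreal (exp (- (LINT s:{0..t}|lborel. V (\<omega> s)))) \<partial>P)
     \<le> ennreal (exp (2 * \<delta>) * (exp (- ((\<delta> + c * S) * t)) + exp (- (c * S)) * exp (- (\<delta> * t))))" (is "?L \<le> ennreal ?R")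
proof (cases "t \<le> 1")
  case True
  \<comment> \<open>A single skeleton point with \<open>h = t\<close>: there are no later
    increments, so \<open>q = 1\<close> and \<open>p = 0\<close> do.\<close>
  have "?L \<le> ennreal (exp (- (c * t * (\<Sum>i<d. \<bar>x i\<bar> powr \<alpha>))) * 1 ^ 0)"
  proof (rule wiener_exp_integral_bound[OF W d Vm \<alpha> m M t True lower upper c[OF _ _ t True]])
    have "(\<integral>\<^sup>+y. ennreal (normal_density 0 (sqrt t) y * exp (- (t * (m / 8) * \<bar>y\<bar> powr \<alpha>))) \<partial>lborel)
        \<le> (\<integral>\<^sup>+y. ennreal (normal_density 0 (sqrt t) y) \<partial>lborel)"
      using t m by (intro nn_integral_mono ennreal_leI) (simp add: mult_left_le)
    then show "(\<integral>\<^sup>+y. ennreal (normal_density 0 (sqrt t) y * exp (- (t * (m / 8) * \<bar>y\<bar> powr \<alpha>))) \<partial>lborel) \<le> ennreal 1"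
      using t by (simp add: nn_integral_normal_density)
  qed simp_all
  also have "\<dots> \<le> ennreal ?R"
  proof (intro ennreal_leI)
    have "exp (- (c * t * S)) \<le> exp (2 * \<delta> + - ((\<delta> + c * S) * t))"
      using True mult_left_mono[OF True, of \<delta>] \<delta> by (simp add: algebra_simps)
    also have "\<dots> \<le> ?R" unfolding exp_add by (simp add: distrib_left)
    finally show "exp (- (c * t * (\<Sum>i<d. \<bar>x i\<bar> powr \<alpha>))) * 1 ^ 0 \<le> ?R"
      by (simp add: S)
  qed
  finally show ?thesis .
next
  case False
  \<comment> \<open>With unit steps \<open>\<lfloor>t\<rfloor>\<close> skeleton points fit, and
    between them lie \<open>\<lfloor>t\<rfloor> - 1\<close> increments, each giving a factor
    \<open>exp (- \<delta>)\<close>.\<close>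
  define p where "p = nat \<lfloor>t\<rfloor> - 1"
  have p: "real (Suc p) \<le> t" "t \<le> real p + 2"
    using False by (auto simp: p_def of_nat_diff) linarith+
  have "?L \<le> ennreal (exp (- (c * 1 * (\<Sum>i<d. \<bar>x i\<bar> powr \<alpha>))) * exp (- \<delta>) ^ p)"
    by (rule wiener_exp_integral_bound[OF W d Vm \<alpha> m M _ _ lower upper c]) (use p \<delta> in simp_all)
  also have "\<dots> \<le> ennreal ?R"
  proof (intro ennreal_leI)
    have "exp (- \<delta>) ^ p = exp (- (\<delta> * real p))"
      by (simp add: exp_of_nat_mult[symmetric] mult_ac)
    also have "\<dots> \<le> exp (2 * \<delta> + - (\<delta> * t))"
      using mult_left_mono[OF p(2), of \<delta>] \<delta> by (simp add: algebra_simps)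
    finally have "exp (- (c * S)) * exp (- \<delta>) ^ p \<le> exp (- (c * S)) * (exp (2 * \<delta>) * exp (- (\<delta> * t)))"
      unfolding exp_add by (intro mult_left_mono) auto
    also have "\<dots> \<le> ?R" by (simp add: algebra_simps)
    finally show "exp (- (c * 1 * (\<Sum>i<d. \<bar>x i\<bar> powr \<alpha>))) * exp (- \<delta>) ^ p \<le> ?R"
      by (simp add: S)
  qed
  finally show ?thesis .
qed

lemma norm_semigroup_L_le:
  fixes f :: "(nat \<Rightarrow> real) \<Rightarrow> complex"
  assumes W: "wiener_measure d x (W x)" and d: "0 < d" and t: "0 < t"
    and f: "AE y in Rd d. norm (f y) \<le> K" and K: "0 \<le> K"
    and V: "V \<in> borel_measurable (Rd d)"
    and B: "(\<integral>\<^sup>+\<omega>. ennreal (exp (- (LINT s:{0..t}|lborel. V (\<omega> s)))) \<partial>W x) \<le> ennreal B" "0 \<le> B"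
  shows "norm (semigroup_L W V t f x) \<le> K * B"
proof -
  let ?g = "\<lambda>\<omega>. exp (- (LINT s:{0..t}|lborel. V (\<omega> s))) *\<^sub>R f (\<omega> t)"
  have "ennreal (norm (semigroup_L W V t f x)) \<le> (\<integral>\<^sup>+\<omega>. ennreal (norm (?g \<omega>)) \<partial>W x)"
    unfolding semigroup_L_def
  \<comment> \<open>If the integrand is not integrable, the Bochner integral is 0 and the bound is
    trivial.\<close>
  proof (cases "integrable (W x) ?g")
    case True
    then show "ennreal (norm (LINT \<omega>|W x. ?g \<omega>)) \<le> (\<integral>\<^sup>+\<omega>. ennreal (norm (?g \<omega>)) \<partial>W x)"
      by (rule integral_norm_bound_ennreal)
  qed (simp add: not_integrable_integral_eq)
  also have "\<dots> \<le> (\<integral>\<^sup>+\<omega>. ennreal K * ennreal (exp (- (LINT s:{0..t}|lborel. V (\<omega> s)))) \<partial>W x)"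
  proof (intro nn_integral_mono_AE)
    show "AE \<omega> in W x. ennreal (norm (?g \<omega>)) \<le> ennreal K * ennreal (exp (- (LINT s:{0..t}|lborel. V (\<omega> s))))"
      using AE_wiener_eval[OF W d t f]
    proof eventually_elim
      case (elim \<omega>)
      then show ?case
        using K by (subst ennreal_mult[symmetric]) (auto intro!: ennreal_leI mult_right_mono simp: mult.commute[of "exp _"])
    qed
  qed
  also have "\<dots> \<le> ennreal K * ennreal B"
  proof -
    have "(\<lambda>\<omega>. ennreal (exp (- (LINT s:{0..t}|lborel. V (\<omega> s))))) \<in> borel_measurable (W x)"
      using measurable_wiener_path_integral[OF W V, of t] by measurable
    then show ?thesis
      using B by (simp only: nn_integral_cmult) (auto intro: mult_left_mono)
  qed
  also have "\<dots> = ennreal (K * B)"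
    using K B by (simp add: ennreal_mult)
  finally show ?thesis
    using K B by (subst (asm) ennreal_le_iff) auto
qed

section \<open>Boundedness of the Riesz transform\<close>

text \<open>Over a null space the essential supremum would be negative infinity. Brownian motion at
  time 1 carries the almost everywhere bound to a probability space, where it forces the norm to be
  non-negative and hence finite.\<close>

lemma Linf_normE:
  assumes f: "f \<in> Linf d" and W: "wiener_measure d x P" and d: "0 < d"
  obtains K where "0 \<le> K" "Linf_norm d f = ereal K" "AE y in Rd d. norm (f y) \<le> K"
proof -
  interpret prob_space P using wiener_measureD(1)[OF W] .
  have AE: "AE y in Rd d. ereal (norm (f y)) \<le> Linf_norm d f"
    unfolding Linf_norm_def by (rule esssup_AE)
  then have "AE \<omega> in P. ereal (norm (f (\<omega> 1))) \<le> Linf_norm d f"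
    using AE_wiener_eval[OF W d, of 1] by simp
  then have "AE \<omega> in P. 0 \<le> Linf_norm d f"
    by (rule eventually_mono) (meson ereal_less_eq(5) norm_ge_zero order_trans)
  then have "0 \<le> Linf_norm d f" by simp
  moreover have "Linf_norm d f < \<infinity>" using f by (simp add: Linf_def)
  ultimately obtain K where K: "Linf_norm d f = ereal K" "0 \<le> K"
    by (cases "Linf_norm d f") auto
  show thesis
    by (rule that[OF K(2,1)]) (use AE K in simp)
qed

text \<open>This is \<open>z \<le> exp z\<close> at \<open>z = c * S / a\<close>, raised to the
  power \<open>a\<close>.\<close>

lemma powr_mult_exp_le:
  fixes a c S :: real
  assumes "0 < a" "0 < c" "0 \<le> S"
  shows "S powr a * exp (- (c * S)) \<le> (a / c) powr a"
proof -
  have "c * S / a \<le> exp (c * S / a)"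
    by (rule order_trans[OF _ exp_ge_add_one_self]) simp
  then have "S * exp (- (c * S / a)) \<le> a / c"
    using assms by (simp add: exp_minus field_simps)
  then have "(S * exp (- (c * S / a))) powr a \<le> (a / c) powr a"
    using assms by (intro powr_mono2) auto
  then show ?thesis
    using assms by (simp add: powr_mult exp_powr_real)
qed

theorem theorem1p1:
  fixes \<alpha> m M a :: real
  assumes "0 < \<alpha>" and "\<alpha> \<le> 2" and "0 < m" and "0 < M" and "0 < a"
  shows "\<exists>C::real. C > 0 \<and>
    (\<forall>(d::nat) (v :: nat \<Rightarrow> real \<Rightarrow> real) (V :: (nat \<Rightarrow> real) \<Rightarrow> real)
       (W :: (nat \<Rightarrow> real) \<Rightarrow> (real \<Rightarrow> nat \<Rightarrow> real) measure) (f :: (nat \<Rightarrow> real) \<Rightarrow> complex).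
       d \<ge> 1 \<longrightarrow>
       (\<forall>i<d. v i \<in> borel_measurable borel) \<longrightarrow>
       (\<forall>i<d. \<forall>y. m * \<bar>y\<bar> powr \<alpha> \<le> v i y \<and> v i y \<le> M * \<bar>y\<bar> powr \<alpha>) \<longrightarrow>
       (\<forall>x\<in>space (Rd d). V x = (\<Sum>i<d. v i (x i))) \<longrightarrow>
       (\<forall>x\<in>space (Rd d). wiener_measure d x (W x)) \<longrightarrow>
       f \<in> Linf d \<longrightarrow>
       (\<forall>x\<in>space (Rd d). set_integrable lborel {0<..}
          (\<lambda>t. t powr (a - 1) *\<^sub>R semigroup_L W V t f x)) \<and>
       Linf_norm d (riesz_transform W V a f) \<le> ereal C * Linf_norm d f)"
proof -
  \<comment> \<open>The rate \<open>m / 2\<close> belongs to the half of the first skeleton sum that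
    is kept for the start; the \<open>m / 8\<close> below is the weight of each increment in
    \<open>skeleton_sum_lower_bound\<close>.\<close>
  obtain c where c0: "0 < c" and c: "\<And>s h z. 0 < s \<Longrightarrow> s \<le> 1 \<Longrightarrow> 0 < h \<Longrightarrow> h \<le> 1 \<Longrightarrow>
        (\<integral>\<^sup>+y. ennreal (normal_density 0 (sqrt s) y * exp (- (h * (m / 2) * \<bar>z + y\<bar> powr \<alpha>))) \<partial>lborel)
         \<le> ennreal (exp (- (c * (h * \<bar>z\<bar> powr \<alpha>))))"
    by (rule gaussian_damping[OF assms(1,2) half_gt_zero[OF assms(3)]]) (rule that)
  obtain \<delta> where \<delta>: "0 < \<delta>"
    "(\<integral>\<^sup>+y. ennreal (normal_density 0 1 y * exp (- (m / 8 * \<bar>y\<bar> powr \<alpha>))) \<partial>lborel) \<le> ennreal (exp (- \<delta>))"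
    by (rule gaussian_damping_strict[of "m / 8" \<alpha>]) (use assms(3) that in simp_all)
  \<comment> \<open>\<open>M powr a\<close> comes from the multiplier, and the two summands bound
    \<open>S powr a\<close> times the two time integrals; \<open>Gamma a\<close> cancels against the
    normalisation.\<close>
  define C where "C = exp (2 * \<delta>) * M powr a * (1 / c powr a + (a / c) powr a / \<delta> powr a)"
  have "0 < C" using assms c0 \<delta> by (simp add: C_def add_pos_pos)
  moreover have "(\<forall>x\<in>space (Rd d). set_integrable lborel {0<..}
          (\<lambda>t. t powr (a - 1) *\<^sub>R semigroup_L W V t f x)) \<and>
       Linf_norm d (riesz_transform W V a f) \<le> ereal C * Linf_norm d f"
    if d: "d \<ge> 1" and vm: "\<forall>i<d. v i \<in> borel_measurable borel"
      and v: "\<forall>i<d. \<forall>y. m * \<bar>y\<bar> powr \<alpha> \<le> v i y \<and> v i y \<le> M * \<bar>y\<bar> powr \<alpha>"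
      and V: "\<forall>x\<in>space (Rd d). V x = (\<Sum>i<d. v i (x i))"
      and W: "\<forall>x\<in>space (Rd d). wiener_measure d x (W x)" and f: "f \<in> Linf d"
    for d and v :: "nat \<Rightarrow> real \<Rightarrow> real" and V :: "(nat \<Rightarrow> real) \<Rightarrow> real" and W and f :: "(nat \<Rightarrow> real) \<Rightarrow> complex"
  proof -
    have d0: "0 < d" using d by simp
    have fm: "f \<in> borel_measurable (Rd d)" using f by (simp add: Linf_def)
    have Vm: "V \<in> borel_measurable (Rd d)"
    proof (subst measurable_cong)
      show "V x = (\<Sum>i<d. v i (x i))" if "x \<in> space (Rd d)" for x using V that by simp
      show "(\<lambda>x. \<Sum>i<d. v i (x i)) \<in> borel_measurable (Rd d)"
        using vm by (intro borel_measurable_sum measurable_compose[OF measurable_Rd_component[where g = "\<lambda>x. x"]]) auto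
    qed
    have lower: "m * (\<Sum>i<d. \<bar>y i\<bar> powr \<alpha>) \<le> V y" if "y \<in> space (Rd d)" for y
      using V that v by (auto simp: sum_distrib_left intro!: sum_mono)
    have upper: "V y \<le> M * (\<Sum>i<d. \<bar>y i\<bar> powr \<alpha>)" if "y \<in> space (Rd d)" for y
      using V that v by (auto simp: sum_distrib_left intro!: sum_mono)
    obtain K where K: "0 \<le> K" "Linf_norm d f = ereal K" "AE y in Rd d. norm (f y) \<le> K"
      using Linf_normE[OF f _ d0] W origin_in_Rd by blast
    let ?g = "\<lambda>x t. t powr (a - 1) *\<^sub>R semigroup_L W V t f x"
    \<comment> \<open>As a non-negative integral the bound needs no integrability, so it first
      yields integrability and then the estimate of the norm.\<close>
    have main: "(\<integral>\<^sup>+t. ennreal (norm (indicator {0<..} t *\<^sub>R ?g x t)) \<partial>lborel)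
        \<le> ennreal (K * exp (2 * \<delta>) * Gamma a * (1 / (\<delta> + c * S) powr a + exp (- (c * S)) / \<delta> powr a))"
      if x: "x \<in> space (Rd d)" and S: "S = (\<Sum>i<d. \<bar>x i\<bar> powr \<alpha>)" for x S
    proof -
      have S0: "0 \<le> S" by (simp add: S sum_nonneg)
      define E where "E b t = indicator {0<..} t * (t powr (a - 1) * exp (- (b * t)))" for b t :: real
      have E0: "0 \<le> E b t" for b t by (simp add: E_def)
      have E: "(\<integral>\<^sup>+t. ennreal (E b t) \<partial>lborel) = ennreal (Gamma a / b powr a)" if "0 < b" for b
        unfolding E_def using assms that by (intro nn_integral_powr_exp) auto
      have [measurable]: "E b \<in> borel_measurable borel" for b unfolding E_def by measurable
      have pw: "norm (indicator {0<..} t *\<^sub>R ?g x t)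
          \<le> K * exp (2 * \<delta>) * E (\<delta> + c * S) t + K * exp (2 * \<delta>) * exp (- (c * S)) * E \<delta> t" for t
      proof (cases "0 < t")
        case True
        define B where "B = exp (2 * \<delta>) * (exp (- ((\<delta> + c * S) * t)) + exp (- (c * S)) * exp (- (\<delta> * t)))"
        have "norm (semigroup_L W V t f x) \<le> K * B"
        proof (rule norm_semigroup_L_le[OF _ d0 True K(3,1) Vm])
          show Wx: "wiener_measure d x (W x)" using W x by simp
          show "(\<integral>\<^sup>+\<omega>. ennreal (exp (- (LINT s:{0..t}|lborel. V (\<omega> s)))) \<partial>W x) \<le> ennreal B"
            unfolding B_def using assms
            by (intro wiener_exp_integral_decay[OF Wx d0 Vm _ _ _ _ lower upper c \<delta> S True]) auto
          show "0 \<le> B" by (simp add: B_def add_nonneg_nonneg)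
        qed
        then have "t powr (a - 1) * norm (semigroup_L W V t f x) \<le> t powr (a - 1) * (K * B)"
          by (intro mult_left_mono) auto
        then show ?thesis using True by (simp add: E_def B_def algebra_simps)
      qed (simp add: E_def)
      have "(\<integral>\<^sup>+t. ennreal (norm (indicator {0<..} t *\<^sub>R ?g x t)) \<partial>lborel)
          \<le> (\<integral>\<^sup>+t. ennreal (K * exp (2 * \<delta>)) * ennreal (E (\<delta> + c * S) t)
              + ennreal (K * exp (2 * \<delta>) * exp (- (c * S))) * ennreal (E \<delta> t) \<partial>lborel)"
        using pw K(1) E0
        by (intro nn_integral_mono)
          (simp add: ennreal_mult[symmetric] ennreal_plus[symmetric] del: ennreal_plus)
      also have "\<dots> = ennreal (K * exp (2 * \<delta>)) * ennreal (Gamma a / (\<delta> + c * S) powr a)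
          + ennreal (K * exp (2 * \<delta>) * exp (- (c * S))) * ennreal (Gamma a / \<delta> powr a)"
        using E[of "\<delta> + c * S"] E[of \<delta>] \<delta> c0 S0
        by (simp add: nn_integral_add nn_integral_cmult add_pos_nonneg)
      also have "\<dots> = ennreal (K * exp (2 * \<delta>) * (Gamma a / (\<delta> + c * S) powr a)
          + K * exp (2 * \<delta>) * exp (- (c * S)) * (Gamma a / \<delta> powr a))"
        using K(1) Gamma_real_pos[OF assms(5)]
        by (simp add: ennreal_mult[symmetric] ennreal_plus[symmetric] del: ennreal_plus)
      also have "\<dots> = ennreal (K * exp (2 * \<delta>) * Gamma a * (1 / (\<delta> + c * S) powr a + exp (- (c * S)) / \<delta> powr a))"
        by (simp add: algebra_simps)
      finally show ?thesis .
    qed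
    have int: "set_integrable lborel {0<..} (?g x)" if x: "x \<in> space (Rd d)" for x
    proof -
      have "(\<lambda>t. indicator {0<..} t *\<^sub>R ?g x t) \<in> borel_measurable lborel"
        using measurable_semigroup_L_time[OF Vm fm _ d0 x, of W a] W by (simp add: set_borel_measurable_def)
      then show ?thesis
        unfolding set_integrable_def using main[OF x refl]
        by (intro integrableI_bounded) (auto intro: le_less_trans)
    qed
    have bound: "norm (riesz_transform W V a f x) \<le> C * K" if x: "x \<in> space (Rd d)" for x
    proof -
      define S where "S = (\<Sum>i<d. \<bar>x i\<bar> powr \<alpha>)"
      have S0: "0 \<le> S" by (simp add: S_def sum_nonneg)
      let ?D = "1 / (\<delta> + c * S) powr a + exp (- (c * S)) / \<delta> powr a"
      have D0: "0 \<le> ?D" by simp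
      have G: "0 < Gamma a" using Gamma_real_pos[OF assms(5)] .
      have "ennreal (norm (LINT t:{0<..}|lborel. ?g x t)) \<le> (\<integral>\<^sup>+t. ennreal (norm (indicator {0<..} t *\<^sub>R ?g x t)) \<partial>lborel)"
        unfolding set_lebesgue_integral_def
        using int[OF x] by (intro integral_norm_bound_ennreal) (simp add: set_integrable_def)
      also note main[OF x S_def]
      finally have I: "norm (LINT t:{0<..}|lborel. ?g x t) \<le> K * exp (2 * \<delta>) * Gamma a * ?D"
        using K(1) G D0 by (subst (asm) ennreal_le_iff) auto
      have "0 \<le> V x" using lower[OF x] S0 assms(3) unfolding S_def[symmetric]
        by (meson mult_nonneg_nonneg order_trans less_imp_le)
      then have "V x powr a \<le> (M * S) powr a"
        using upper[OF x] assms(5) unfolding S_def by (intro powr_mono2) auto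
      also have "\<dots> = M powr a * S powr a" using assms S0 by (simp add: powr_mult)
      finally have Va: "V x powr a \<le> M powr a * S powr a" .
      \<comment> \<open>In the first summand \<delta> keeps the denominator positive at
        \<open>S = 0\<close>, and \<open>S / (\<delta> + c * S) \<le> 1 / c\<close> for every
        \<open>S\<close>; in the second the exponential absorbs the power of
        \<open>S\<close>.\<close>
      have SD: "S powr a * ?D \<le> 1 / c powr a + (a / c) powr a / \<delta> powr a"
      proof -
        have "S powr a / (\<delta> + c * S) powr a = (S / (\<delta> + c * S)) powr a"
          using S0 c0 \<delta> by (simp add: powr_divide)
        also have "\<dots> \<le> (1 / c) powr a"
          using S0 c0 \<delta> assms(5) by (intro powr_mono2) (auto simp: field_simps add_pos_nonneg)
        also have "\<dots> = 1 / c powr a" using c0 by (simp add: powr_divide)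
        finally have "S powr a / (\<delta> + c * S) powr a \<le> 1 / c powr a" .
        moreover have "S powr a * exp (- (c * S)) / \<delta> powr a \<le> (a / c) powr a / \<delta> powr a"
          using powr_mult_exp_le[OF assms(5) c0 S0] by (intro divide_right_mono) auto
        ultimately show ?thesis by (simp add: algebra_simps)
      qed
      have "norm (riesz_transform W V a f x) = V x powr a / Gamma a * norm (LINT t:{0<..}|lborel. ?g x t)"
        using G by (simp add: riesz_transform_def)
      also have "\<dots> \<le> (M powr a * S powr a) / Gamma a * (K * exp (2 * \<delta>) * Gamma a * ?D)"
        using Va I G by (intro mult_mono divide_right_mono) auto
      also have "\<dots> = K * exp (2 * \<delta>) * M powr a * (S powr a * ?D)"
        using G by (simp add: field_simps)
      also have "\<dots> \<le> K * exp (2 * \<delta>) * M powr a * (1 / c powr a + (a / c) powr a / \<delta> powr a)"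
        using K(1) by (intro mult_left_mono SD) auto
      also have "\<dots> = C * K" by (simp add: C_def)
      finally show ?thesis .
    qed
    have "Linf_norm d (riesz_transform W V a f) \<le> ereal (C * K)"
      unfolding Linf_norm_def
    proof (rule esssup_I)
      have [measurable]: "riesz_transform W V a f \<in> borel_measurable (Rd d)"
        using measurable_riesz_transform[OF Vm fm _ d0, of W a] W by simp
      show "(\<lambda>x. ereal (norm (riesz_transform W V a f x))) \<in> borel_measurable (Rd d)"
        by measurable
      show "AE x in Rd d. ereal (norm (riesz_transform W V a f x)) \<le> ereal (C * K)"
        using bound by (intro AE_I2) simp
    qed
    then show ?thesis
      using int K(2) by simp
  qed
  ultimately show ?thesis by blast
qed

end
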